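(* Let $\mathcal{Q}$ denote the set of positive squarefree integers. For almost every real number $a>1$ (with respect to Lebesgue measure) and every $\varepsilon>0$, $$\#\bigl\{n\le x\mid n\notin\mathcal{Q}+\{\lfloor a^m\rfloor\mid m\ge1\}\bigr\}\ll_{a,\varepsilon}\frac{x(\log\log x)^{1+\varepsilon}}{\sqrt{\log x}}.$$ Moreover, $$\#\bigl\{n\le x\mid n\notin\mathcal{Q}+\{\lfloor a^m\rfloor+\lfloor a^\ell\rfloor\mid 1\le m<\ell\}\bigr\}\ll_{a,\varepsilon}\frac{x(\log\log x)^{1+\varepsilon}}{\log x}.$$ In particular, almost all positive integers (that is, all outside a set of asymptotic density zero) can be represented in each of these two forms.
   Context: Here $n$ runs over positive integers, $m,\ell$ are integers, and $\lfloor x\rfloor$ is the greatest integer not exceeding $x$. For sets $X,Y$ of integers, $X+Y=\{x+y\mid x\in X, y\in Y\}$. The estimates are for all sufficiently large $x$, and $\ll_{a,\varepsilon}$ means that the implied constant may depend on $a$ and $\varepsilon$ only. The set of full measure of bases $a$ does not depend on $\varepsilon$. *)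

theory Defs
  imports
    "HOL-Analysis.Analysis"
    "HOL-Computational_Algebra.Squarefree"
    "HOL-Library.Set_Algebras"
    "HOL-Library.Landau_Symbols"
begin

definition squarefree_set :: "int set" where
  "squarefree_set = {q. q > 0 \<and> squarefree q}"

definition floor_powers :: "real \<Rightarrow> int set" where
  "floor_powers a = {\<lfloor>a ^ m\<rfloor> | m :: nat. 1 \<le> m}"

definition floor_power_sums :: "real \<Rightarrow> int set" where
  "floor_power_sums a = {\<lfloor>a ^ m\<rfloor> + \<lfloor>a ^ l\<rfloor> | m l :: nat. 1 \<le> m \<and> m < l}"

text \<open>The \<open>+\<close> below is the elementwise sum of sets from \<^theory>\<open>HOL-Library.Set_Algebras\<close>.\<close>

definition exceptional_set :: "int set \<Rightarrow> int set" where
  "exceptional_set S = {n. n > 0 \<and> n \<notin> squarefree_set + S}"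

definition counting_function :: "int set \<Rightarrow> real \<Rightarrow> nat" where
  "counting_function A x = card {n \<in> A. 0 < n \<and> real_of_int n \<le> x}"

definition has_asymptotic_density :: "int set \<Rightarrow> real \<Rightarrow> bool" where
  "has_asymptotic_density A d \<longleftrightarrow>
     (\<lambda>N :: nat. real (card (A \<inter> {1..int N})) / real N) \<longlonglongrightarrow> d"

end

theory Submission
  imports Defs "HOL-Real_Asymp.Real_Asymp"
begin

text \<open>
  For each scale \<open>k\<close>, the proof uses only exponents that are multiples of a gap of order \<open>k\<close>: the first
  \<open>2 ^ k\<close> multiples for single powers, and the pairs of one of the first \<open>2 ^ k\<close> with one of the next
  \<open>2 ^ k\<close> multiples for sums of two powers. This gives \<open>T = 2 ^ k\<close> or \<open>T = 4 ^ k\<close> shifts \<open>v\<close>. All of them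
  are small compared with \<open>x\<close> as long as \<open>k * 2 ^ k\<close> is at most a small multiple of \<open>ln x\<close>, so \<open>2 ^ k\<close>
  can be taken of order \<open>ln x / ln (ln x)\<close>.

  If \<open>n\<close> is exceptional and exceeds all shifts, every \<open>n - v\<close> is divisible by \<open>d\<^sup>2\<close> for some \<open>d \<ge> 2\<close>.
  As the sum of \<open>1 / d\<^sup>2\<close> over \<open>d \<ge> 2\<close> is at most \<open>3 / 4\<close>, equidistribution of the shifts modulo squares
  would explain this only for three quarters of them. So \<open>n\<close> lies in classes modulo some \<open>d\<^sup>2\<close> with
  \<open>d \<le> 2 ^ k\<close> that contain too many shifts, or many \<open>n - v\<close> are divisible by \<open>d\<^sup>2\<close> with some \<open>d > 2 ^ k\<close>. The
  second event has density of order \<open>1 / 2 ^ k\<close>. By the Chebyshev inequality the density of the first is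
  controlled by the variance of the distribution of the shifts over the classes modulo \<open>d\<^sup>2\<close>
  (\<open>card_not_squarefree_plus_shifts_le\<close>), which is the number of collisions minus its expectation.

  For a random base \<open>a\<close> in a compact interval, two different shifts collide modulo \<open>q\<close> with probability at
  most \<open>1 / q\<close> plus a negligible error (\<open>measure_floor_power_collision_le\<close>): where the integer parts
  of the lower powers are constant, the highest power still runs through many complete periods modulo
  \<open>q\<close>, thanks to the gap. Hence the mean variance is of order \<open>T\<close>, as for independent residues, and by
  the Borel-Cantelli lemma almost every base has variance \<open>T\<close> up to powers of \<open>k\<close> at all large
  scales. The exceptional set up to \<open>x\<close> then has size at most of order \<open>x / 2 ^ k + x (k + 1) ^ 4 / T\<close>, that is,
  \<open>x (ln (ln x)) ^ 5 / ln x\<close> for single powers and \<open>x ln (ln x) / ln x\<close> for sums of two powers. Both bounds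
  imply the asserted ones, and they imply that the exceptional sets have density zero.
\<close>

section \<open>Counting integers that avoid the squarefree numbers under many shifts\<close>

lemma card_residue_class_le:
  fixes q :: nat and X :: nat and c :: int
  assumes "q > 0"
  shows "real (card {n \<in> {1..int X}. n mod int q = c}) \<le> real X / real q + 1"
proof -
  let ?S = "{n \<in> {1..int X}. n mod int q = c}"
  have inj: "inj_on (\<lambda>n. n div int q) ?S"
    by (rule inj_onI) (metis (mono_tags, lifting) div_mult_mod_eq mem_Collect_eq)
  have "card ?S = card ((\<lambda>n. n div int q) ` ?S)"
    using inj by (simp add: card_image)
  also have "\<dots> \<le> card {0..int X div int q}"
    using assms by (intro card_mono) (auto simp: pos_imp_zdiv_nonneg_iff zdiv_mono1)
  also have "\<dots> = X div q + 1"
    by (simp add: zdiv_int[symmetric] nat_add_distrib)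
  finally have "real (card ?S) \<le> real (X div q) + 1" by linarith
  moreover have "real (X div q) \<le> real X / real q"
    by (rule of_nat_div_le_of_nat)
  ultimately show ?thesis by linarith
qed

lemma card_congruent_le:
  fixes q :: nat and X :: nat and c :: int
  assumes "q > 0"
  shows "real (card {n \<in> {1..int X}. int q dvd n - c}) \<le> real X / real q + 1"
proof -
  have "{n \<in> {1..int X}. int q dvd n - c} = {n \<in> {1..int X}. n mod int q = c mod int q}"
    by (auto simp: mod_eq_dvd_iff)
  thus ?thesis using card_residue_class_le[OF assms] by simp
qed

text \<open>The number of shifts \<open>v i\<close> congruent to \<open>n\<close> modulo \<open>q\<close>.\<close>

definition residue_count :: "'i set \<Rightarrow> ('i \<Rightarrow> int) \<Rightarrow> nat \<Rightarrow> int \<Rightarrow> nat" where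
  "residue_count I v q n = card {i \<in> I. int q dvd n - v i}"

text \<open>The variance of the residues modulo \<open>q\<close> of the shifts: the unnormalised sum over all classes of the
  squared deviation of the class count from its mean \<open>card I / q\<close>.\<close>

definition residue_variance :: "'i set \<Rightarrow> ('i \<Rightarrow> int) \<Rightarrow> nat \<Rightarrow> real" where
  "residue_variance I v q =
     (\<Sum>r\<in>{0..<int q}. (real (residue_count I v q r) - real (card I) / real q)\<^sup>2)"

lemma residue_variance_nonneg: "residue_variance I v q \<ge> 0"
  unfolding residue_variance_def by (intro sum_nonneg) auto

lemma residue_count_mod: "residue_count I v q (n mod int q) = residue_count I v q n"
proof -
  have "int q dvd n mod int q - v i \<longleftrightarrow> int q dvd n - v i" for i
    by (metis mod_eq_dvd_iff mod_mod_trivial)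
  thus ?thesis unfolding residue_count_def by simp
qed

lemma residue_count_eq_sum:
  assumes "finite I"
  shows "real (residue_count I v q n) = (\<Sum>i\<in>I. of_bool (int q dvd n - v i))"
  using assms by (simp add: residue_count_def sum.If_cases of_bool_def Int_def)

lemma sum_residue_indicator:
  fixes q :: nat and c :: int
  assumes "q > 0"
  shows "(\<Sum>r\<in>{0..<int q}. of_bool (int q dvd r - c)) = (1 :: real)"
proof -
  have "(\<Sum>r\<in>{0..<int q}. of_bool (int q dvd r - c) :: real) =
        (\<Sum>r\<in>{0..<int q}. if r = c mod int q then 1 else 0)"
  proof (rule sum.cong[OF refl])
    fix r assume r: "r \<in> {0..<int q}"
    hence "int q dvd r - c \<longleftrightarrow> r = c mod int q"
      by (metis atLeastLessThan_iff mod_eq_dvd_iff mod_pos_pos_trivial)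
    thus "of_bool (int q dvd r - c) = (if r = c mod int q then 1 else 0 :: real)" by simp
  qed
  also have "\<dots> = 1" using assms by simp
  finally show ?thesis .
qed

lemma sum_residue_count:
  assumes "finite I" "q > 0"
  shows "(\<Sum>r\<in>{0..<int q}. real (residue_count I v q r)) = real (card I)"
proof -
  have "(\<Sum>r\<in>{0..<int q}. real (residue_count I v q r)) =
        (\<Sum>i\<in>I. \<Sum>r\<in>{0..<int q}. of_bool (int q dvd r - v i))"
    by (subst sum.swap) (simp add: residue_count_eq_sum assms)
  also have "\<dots> = real (card I)"
    by (simp add: sum_residue_indicator assms del: sum_of_bool_eq)
  finally show ?thesis .
qed

lemma sum_residue_count_square:
  assumes "finite I" "q > 0"
  shows "(\<Sum>r\<in>{0..<int q}. (real (residue_count I v q r))\<^sup>2) =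
         (\<Sum>i\<in>I. \<Sum>j\<in>I. of_bool (int q dvd v i - v j))"
proof -
  have "(\<Sum>r\<in>{0..<int q}. (real (residue_count I v q r))\<^sup>2) =
        (\<Sum>r\<in>{0..<int q}. \<Sum>i\<in>I. \<Sum>j\<in>I. of_bool (int q dvd r - v i) * of_bool (int q dvd v i - v j))"
  proof (rule sum.cong[OF refl])
    fix r
    have "(real (residue_count I v q r))\<^sup>2 =
          (\<Sum>i\<in>I. \<Sum>j\<in>I. of_bool (int q dvd r - v i) * of_bool (int q dvd r - v j))"
      by (simp add: residue_count_eq_sum assms power2_eq_square sum_product del: sum_of_bool_eq)
    also have "\<dots> = (\<Sum>i\<in>I. \<Sum>j\<in>I. of_bool (int q dvd r - v i) * of_bool (int q dvd v i - v j))"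
    proof (intro sum.cong refl)
      fix i j
      have "int q dvd r - v j \<longleftrightarrow> int q dvd v i - v j" if "int q dvd r - v i"
        using dvd_add_right_iff[OF that, of "v i - v j"] by simp
      thus "of_bool (int q dvd r - v i) * of_bool (int q dvd r - v j) =
            (of_bool (int q dvd r - v i) * of_bool (int q dvd v i - v j) :: real)"
        by auto
    qed
    finally show "(real (residue_count I v q r))\<^sup>2 = \<dots>" .
  qed
  also have "\<dots> = (\<Sum>i\<in>I. \<Sum>j\<in>I. \<Sum>r\<in>{0..<int q}.
                     of_bool (int q dvd r - v i) * of_bool (int q dvd v i - v j))"
    by (subst sum.swap, rule sum.cong[OF refl], subst sum.swap) simp
  also have "\<dots> = (\<Sum>i\<in>I. \<Sum>j\<in>I. of_bool (int q dvd v i - v j))"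
    by (simp only: sum_distrib_right[symmetric] sum_residue_indicator[OF assms(2)] mult_1)
  finally show ?thesis .
qed

text \<open>The variance is the number of collisions (ordered pairs of congruent shifts, the diagonal
  included) minus its expected value. Upper bounds for the probability of a collision therefore
  bound the mean variance from above.\<close>

lemma residue_variance_eq:
  assumes "finite I" "q > 0"
  shows "residue_variance I v q =
         (\<Sum>i\<in>I. \<Sum>j\<in>I. of_bool (int q dvd v i - v j)) - (real (card I))\<^sup>2 / real q"
proof -
  let ?T = "real (card I)" and ?F = "\<lambda>r. real (residue_count I v q r)"
  have "residue_variance I v q =
        (\<Sum>r\<in>{0..<int q}. (?F r)\<^sup>2 - (2 * ?T / real q) * ?F r + (?T / real q)\<^sup>2)"
    unfolding residue_variance_def by (intro sum.cong refl) (simp add: power2_diff algebra_simps)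
  also have "\<dots> = (\<Sum>r\<in>{0..<int q}. (?F r)\<^sup>2) - (2 * ?T / real q) * (\<Sum>r\<in>{0..<int q}. ?F r)
                  + real q * (?T / real q)\<^sup>2"
    by (simp only: sum.distrib sum_subtractf sum_distrib_left[symmetric]) simp
  also have "(\<Sum>r\<in>{0..<int q}. ?F r) = ?T" by (rule sum_residue_count[OF assms])
  also have "(\<Sum>r\<in>{0..<int q}. (?F r)\<^sup>2) = (\<Sum>i\<in>I. \<Sum>j\<in>I. of_bool (int q dvd v i - v j))"
    by (rule sum_residue_count_square[OF assms])
  also have "(\<Sum>i\<in>I. \<Sum>j\<in>I. of_bool (int q dvd v i - v j)) - (2 * ?T / real q) * ?T
               + real q * (?T / real q)\<^sup>2 =
             (\<Sum>i\<in>I. \<Sum>j\<in>I. of_bool (int q dvd v i - v j)) - ?T\<^sup>2 / real q"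
    using assms(2) by (simp add: field_simps power2_eq_square)
  finally show ?thesis .
qed

text \<open>The interval from 1 to \<open>X\<close> meets each residue class at most \<open>X / q + 1\<close> times, which is at most
  \<open>2 X / q\<close> because \<open>q \<le> X\<close>.\<close>

lemma sum_square_deviation_le:
  fixes q X :: nat
  assumes "q > 0" "q \<le> X"
  shows "(\<Sum>n\<in>{1..int X}. (real (residue_count I v q n) - real (card I) / real q)\<^sup>2)
          \<le> 2 * real X / real q * residue_variance I v q"
proof -
  define D where "D n = (real (residue_count I v q n) - real (card I) / real q)\<^sup>2" for n
  have "(\<Sum>n\<in>{1..int X}. D n) =
        (\<Sum>r\<in>{0..<int q}. \<Sum>n\<in>{n \<in> {1..int X}. n mod int q = r}. D n)"
    using assms by (intro sum.group[symmetric]) auto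
  also have "\<dots> = (\<Sum>r\<in>{0..<int q}. real (card {n \<in> {1..int X}. n mod int q = r}) * D r)"
  proof (rule sum.cong[OF refl])
    fix r
    have "D n = D r" if "n mod int q = r" for n
      using that residue_count_mod[of I v q n] by (simp add: D_def)
    thus "(\<Sum>n\<in>{n \<in> {1..int X}. n mod int q = r}. D n) =
          real (card {n \<in> {1..int X}. n mod int q = r}) * D r"
      by simp
  qed
  also have "\<dots> \<le> (\<Sum>r\<in>{0..<int q}. (2 * real X / real q) * D r)"
  proof (intro sum_mono mult_right_mono)
    fix r
    have "1 \<le> real X / real q" using assms by simp
    thus "real (card {n \<in> {1..int X}. n mod int q = r}) \<le> 2 * real X / real q"
      using card_residue_class_le[OF assms(1), of X r] by simp
  qed (simp add: D_def)
  also have "\<dots> = 2 * real X / real q * residue_variance I v q"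
    by (simp add: residue_variance_def D_def sum_distrib_left)
  finally show ?thesis by (simp add: D_def)
qed

lemma sum_residue_count_le:
  fixes q X :: nat
  assumes "finite I" "q > 0" "q \<le> X"
  shows "(\<Sum>n\<in>{1..int X}. real (residue_count I v q n)) \<le> 2 * real X / real q * real (card I)"
proof -
  have "(\<Sum>n\<in>{1..int X}. real (residue_count I v q n)) =
        (\<Sum>i\<in>I. \<Sum>n\<in>{1..int X}. of_bool (int q dvd n - v i))"
    by (subst sum.swap) (simp add: residue_count_eq_sum assms)
  also have "\<dots> = (\<Sum>i\<in>I. real (card {n \<in> {1..int X}. int q dvd n - v i}))"
    by (simp add: Int_def)
  also have "\<dots> \<le> (\<Sum>i\<in>I. 2 * real X / real q)"
  proof (rule sum_mono)
    fix i
    have "1 \<le> real X / real q" using assms by simp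
    thus "real (card {n \<in> {1..int X}. int q dvd n - v i}) \<le> 2 * real X / real q"
      using card_congruent_le[OF assms(2), of X "v i"] by simp
  qed
  finally show ?thesis by (simp add: mult.commute)
qed

lemma sum_inverse_squares_tail:
  fixes P R :: nat
  assumes "P \<ge> 1"
  shows "(\<Sum>d\<in>{P<..R}. 1 / (real d)\<^sup>2) \<le> 1 / real P"
proof (cases "P \<le> R")
  case True
  hence "(\<Sum>d\<in>{P<..R}. 1 / (real d)\<^sup>2) \<le> 1 / real P - 1 / real R"
  proof (induction R rule: dec_induct)
    case (step R)
    have "{P<..Suc R} = insert (Suc R) {P<..R}" using step by auto
    hence "(\<Sum>d\<in>{P<..Suc R}. 1 / (real d)\<^sup>2) \<le> 1 / (real (Suc R))\<^sup>2 + (1 / real P - 1 / real R)"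
      using step by simp
    also have "1 / (real (Suc R))\<^sup>2 \<le> 1 / real R - 1 / real (Suc R)"
    proof -
      have R: "real R > 0" using step assms by simp
      have "1 / (real (Suc R))\<^sup>2 \<le> 1 / (real R * real (Suc R))"
        unfolding power2_eq_square using R by (intro divide_left_mono mult_right_mono) auto
      also have "\<dots> = 1 / real R - 1 / real (Suc R)"
        using R by (simp add: field_simps)
      finally show ?thesis .
    qed
    finally show ?case by simp
  qed simp
  thus ?thesis by (smt (verit) divide_nonneg_nonneg of_nat_0_le_iff)
qed simp

text \<open>The argument needs only that this sum stays bounded away from 1: for shifts that are
  equidistributed modulo squares, a positive proportion of the differences \<open>n - v i\<close> would have no
  square factor.\<close>

lemma sum_inverse_squares_from_2:
  "(\<Sum>d\<in>{2..P::nat}. 1 / (real d)\<^sup>2) \<le> 3 / 4"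
proof (cases "P \<ge> 2")
  case True
  hence "{2..P} = insert 2 {2<..P}" by auto
  thus ?thesis using sum_inverse_squares_tail[of 2 P] by simp
qed simp

lemma not_squarefree_int_obtains:
  fixes n :: int
  assumes "n > 0" "\<not> squarefree n"
  obtains d :: nat where "d \<ge> 2" "int (d\<^sup>2) dvd n" "int (d\<^sup>2) \<le> n"
proof -
  obtain x where x: "x\<^sup>2 dvd n" "\<not> x dvd 1" using assms by (auto simp: squarefree_def)
  define d where "d = nat \<bar>x\<bar>"
  have "x \<noteq> 0" using x assms by auto
  moreover have "\<bar>x\<bar> \<noteq> 1" using x by auto
  ultimately have "d \<ge> 2" by (auto simp: d_def)
  moreover have "int (d\<^sup>2) = x\<^sup>2" by (simp add: d_def)
  ultimately show ?thesis using that x assms by (metis zdvd_imp_le)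
qed

text \<open>The second moment bound. If no \<open>n - v i\<close> is squarefree and positive, although \<open>n\<close> exceeds all shifts,
  then every \<open>i\<close> is counted by some \<open>d \<ge> 2\<close> with \<open>d\<^sup>2\<close> dividing \<open>n - v i\<close>. For \<open>d \<le> P\<close> the expected
  contributions add up to at most three quarters of the number \<open>T\<close> of shifts, so either the deviations
  from the mean for \<open>d \<le> P\<close>, or the contributions of all \<open>d > P\<close>, amount to at least \<open>T / 8\<close>. The former is
  rare by the Chebyshev inequality, the latter by the Markov inequality.\<close>

lemma card_not_squarefree_plus_shifts_le:
  fixes I :: "'i set" and v :: "'i \<Rightarrow> int" and P V X :: nat
  assumes I: "finite I" "I \<noteq> {}" and v: "\<And>i. i \<in> I \<Longrightarrow> 0 \<le> v i \<and> v i \<le> int V"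
    and P: "P \<ge> 2" "P\<^sup>2 \<le> X"
  defines "T \<equiv> real (card I)"
  defines "E \<equiv> {n \<in> {1..int X}. \<forall>i\<in>I. n - v i \<notin> squarefree_set}"
  shows "real (card E) \<le> real V + 16 * real X / real P + 128 * real X / T\<^sup>2 *
            (\<Sum>d\<in>{2..P}. 1 / real d) * (\<Sum>d\<in>{2..P}. residue_variance I v (d\<^sup>2) / real d)"
proof -
  define F where "F d n = real (residue_count I v (d\<^sup>2) n)" for d n
  define D where "D d n = F d n - T / real (d\<^sup>2)" for d n
  define R where "R = {d\<in>{P<..X}. d\<^sup>2 \<le> X}"
  define tail where "tail n = (\<Sum>d\<in>R. F d n)" for n
  define H where "H = (\<Sum>d\<in>{2..P}. 1 / real d)"
  have T: "T > 0" using I by (simp add: T_def card_gt_0_iff)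
  have Fnn: "F d n \<ge> 0" for d n by (simp add: F_def)
  have finR: "finite R" by (simp add: R_def)
  have tailnn: "tail n \<ge> 0" for n by (simp add: tail_def Fnn sum_nonneg)
  \<comment> \<open>A pointwise majorant of the indicator of the bad \<open>n\<close>; summing it gives the bound.\<close>
  have key: "1 \<le> 8 / T * tail n + 64 / T\<^sup>2 * (\<Sum>d\<in>{2..P}. D d n)\<^sup>2"
    if n: "n \<in> E" "n > int V" for n
  proof -
    have cover: "1 \<le> (\<Sum>d\<in>{2..P} \<union> R. of_bool (int (d\<^sup>2) dvd n - v i) :: real)" if i: "i \<in> I" for i
    proof -
      have pos: "n - v i > 0" using v[OF i] n by auto
      have "\<not> squarefree (n - v i)" using n(1) i pos by (auto simp: E_def squarefree_set_def)
      then obtain d where d: "d \<ge> 2" "int (d\<^sup>2) dvd n - v i" "int (d\<^sup>2) \<le> n - v i"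
        using not_squarefree_int_obtains[OF pos] by blast
      have "n \<le> int X" using n by (simp add: E_def)
      hence "int (d\<^sup>2) \<le> int X" using d(3) v[OF i] by linarith
      hence dX: "d\<^sup>2 \<le> X" by (simp only: of_nat_le_iff)
      moreover have "d \<le> d\<^sup>2" by (simp add: power2_eq_square)
      ultimately have mem: "d \<in> {2..P} \<union> R" using d(1) by (auto simp: R_def)
      have "of_bool (int (d\<^sup>2) dvd n - v i) \<le> (\<Sum>d\<in>{2..P} \<union> R. of_bool (int (d\<^sup>2) dvd n - v i) :: real)"
        using mem finR by (intro member_le_sum) auto
      thus ?thesis using d(2) by simp
    qed
    have "T = (\<Sum>i\<in>I. 1)" by (simp add: T_def)
    also have "\<dots> \<le> (\<Sum>i\<in>I. \<Sum>d\<in>{2..P} \<union> R. of_bool (int (d\<^sup>2) dvd n - v i))"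
      by (intro sum_mono cover)
    also have "\<dots> = (\<Sum>d\<in>{2..P} \<union> R. F d n)"
      by (subst sum.swap) (simp add: F_def residue_count_eq_sum[OF I(1)])
    also have "\<dots> = (\<Sum>d\<in>{2..P}. F d n) + tail n"
      unfolding tail_def by (intro sum.union_disjoint finR) (auto simp: R_def)
    also have "(\<Sum>d\<in>{2..P}. F d n) = (\<Sum>d\<in>{2..P}. D d n) + T * (\<Sum>d\<in>{2..P}. 1 / (real d)\<^sup>2)"
      by (simp add: D_def sum_subtractf sum_distrib_left)
    also have "T * (\<Sum>d\<in>{2..P}. 1 / (real d)\<^sup>2) \<le> T * (3 / 4)"
      using T sum_inverse_squares_from_2 by (intro mult_left_mono) auto
    finally have "T / 4 \<le> (\<Sum>d\<in>{2..P}. D d n) + tail n" by simp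
    then consider "T / 8 \<le> tail n" | "T / 8 \<le> (\<Sum>d\<in>{2..P}. D d n)" by linarith
    thus ?thesis
    proof cases
      case 1
      hence "1 \<le> 8 / T * tail n" using T by (simp add: field_simps)
      thus ?thesis by (smt (verit) divide_nonneg_nonneg mult_nonneg_nonneg zero_le_power2)
    next
      case 2
      hence "(T / 8)\<^sup>2 \<le> (\<Sum>d\<in>{2..P}. D d n)\<^sup>2" using T by (intro power_mono) auto
      hence "1 \<le> 64 / T\<^sup>2 * (\<Sum>d\<in>{2..P}. D d n)\<^sup>2" using T by (simp add: field_simps)
      moreover have "0 \<le> 8 / T * tail n" using T tailnn by simp
      ultimately show ?thesis by linarith
    qed
  qed
  have sum_tail: "(\<Sum>n\<in>{1..int X}. tail n) \<le> 2 * real X * T / real P"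
  proof -
    have "(\<Sum>n\<in>{1..int X}. tail n) = (\<Sum>d\<in>R. \<Sum>n\<in>{1..int X}. F d n)"
      unfolding tail_def by (rule sum.swap)
    also have "\<dots> \<le> (\<Sum>d\<in>R. 2 * real X * T * (1 / (real d)\<^sup>2))"
    proof (rule sum_mono)
      fix d assume "d \<in> R"
      hence "d\<^sup>2 > 0" "d\<^sup>2 \<le> X" by (auto simp: R_def)
      from sum_residue_count_le[OF I(1) this, of v]
      show "(\<Sum>n\<in>{1..int X}. F d n) \<le> 2 * real X * T * (1 / (real d)\<^sup>2)"
        by (simp add: F_def T_def)
    qed
    also have "\<dots> \<le> 2 * real X * T * (\<Sum>d\<in>{P<..X}. 1 / (real d)\<^sup>2)"
      unfolding sum_distrib_left[symmetric] using T
      by (intro mult_left_mono sum_mono2) (auto simp: R_def)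
    also have "\<dots> \<le> 2 * real X * T * (1 / real P)"
      using T P by (intro mult_left_mono sum_inverse_squares_tail) auto
    finally show ?thesis by simp
  qed
  have sum_D: "(\<Sum>n\<in>{1..int X}. (\<Sum>d\<in>{2..P}. D d n)\<^sup>2) \<le>
      2 * real X * H * (\<Sum>d\<in>{2..P}. residue_variance I v (d\<^sup>2) / real d)"
  proof -
    have "(\<Sum>d\<in>{2..P}. D d n)\<^sup>2 \<le> H * (\<Sum>d\<in>{2..P}. real d * (D d n)\<^sup>2)" for n
    proof -
      \<comment> \<open>Cauchy-Schwarz with weights \<open>1 / d\<close>, so that the sum over \<open>d\<close> costs only logarithms of \<open>P\<close>.\<close>
      have "(\<Sum>d\<in>{2..P}. D d n) = (\<Sum>d\<in>{2..P}. (1 / sqrt (real d)) * (sqrt (real d) * D d n))"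
        by (intro sum.cong) auto
      also have "(\<dots>)\<^sup>2 \<le> (\<Sum>d\<in>{2..P}. (1 / sqrt (real d))\<^sup>2) * (\<Sum>d\<in>{2..P}. (sqrt (real d) * D d n)\<^sup>2)"
        by (rule Cauchy_Schwarz_ineq_sum)
      finally show ?thesis by (simp add: H_def power_divide power_mult_distrib)
    qed
    hence "(\<Sum>n\<in>{1..int X}. (\<Sum>d\<in>{2..P}. D d n)\<^sup>2) \<le>
           (\<Sum>n\<in>{1..int X}. H * (\<Sum>d\<in>{2..P}. real d * (D d n)\<^sup>2))"
      by (rule sum_mono)
    also have "\<dots> = H * (\<Sum>d\<in>{2..P}. real d * (\<Sum>n\<in>{1..int X}. (D d n)\<^sup>2))"
      unfolding sum_distrib_left by (rule sum.swap)
    also have "\<dots> \<le> H * (\<Sum>d\<in>{2..P}. real d * (2 * real X / real (d\<^sup>2) * residue_variance I v (d\<^sup>2)))"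
    proof (intro mult_left_mono sum_mono)
      fix d assume d: "d \<in> {2..P}"
      hence "d\<^sup>2 \<le> P\<^sup>2" by (intro power_mono) auto
      hence "d\<^sup>2 > 0" "d\<^sup>2 \<le> X" using d P(2) by (simp, linarith)
      from sum_square_deviation_le[OF this, of I v]
      show "(\<Sum>n\<in>{1..int X}. (D d n)\<^sup>2) \<le> 2 * real X / real (d\<^sup>2) * residue_variance I v (d\<^sup>2)"
        by (simp add: D_def F_def T_def)
    qed (auto simp: H_def intro!: sum_nonneg)
    also have "(\<Sum>d\<in>{2..P}. real d * (2 * real X / real (d\<^sup>2) * residue_variance I v (d\<^sup>2))) =
               2 * real X * (\<Sum>d\<in>{2..P}. residue_variance I v (d\<^sup>2) / real d)"
      unfolding sum_distrib_left by (intro sum.cong refl) (auto simp: power2_eq_square)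
    finally show ?thesis by (simp only: mult_ac)
  qed
  have finE: "finite E" by (rule finite_subset[of _ "{1..int X}"]) (auto simp: E_def)
  have "card E \<le> card ({1..int V} \<union> {n\<in>E. n > int V})"
    using finE by (intro card_mono) (simp, auto simp: E_def)
  also have "\<dots> \<le> V + card {n\<in>E. n > int V}"
    using card_Un_le[of "{1..int V}" "{n\<in>E. n > int V}"] by simp
  finally have "real (card E) \<le> real V + (\<Sum>n\<in>{n\<in>E. n > int V}. 1)" by simp
  also have "(\<Sum>n\<in>{n\<in>E. n > int V}. 1) \<le>
     (\<Sum>n\<in>{n\<in>E. n > int V}. 8 / T * tail n + 64 / T\<^sup>2 * (\<Sum>d\<in>{2..P}. D d n)\<^sup>2)"
    by (intro sum_mono key) auto
  also have "\<dots> \<le> (\<Sum>n\<in>{1..int X}. 8 / T * tail n + 64 / T\<^sup>2 * (\<Sum>d\<in>{2..P}. D d n)\<^sup>2)"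
    using T tailnn by (intro sum_mono2) (auto simp: E_def)
  also have "\<dots> = 8 / T * (\<Sum>n\<in>{1..int X}. tail n) +
                   64 / T\<^sup>2 * (\<Sum>n\<in>{1..int X}. (\<Sum>d\<in>{2..P}. D d n)\<^sup>2)"
    by (simp add: sum.distrib sum_distrib_left)
  also have "\<dots> \<le> 8 / T * (2 * real X * T / real P) +
     64 / T\<^sup>2 * (2 * real X * H * (\<Sum>d\<in>{2..P}. residue_variance I v (d\<^sup>2) / real d))"
    using T by (intro add_mono mult_left_mono sum_tail sum_D) auto
  finally show ?thesis using T by (simp add: H_def mult_ac)
qed

section \<open>Residue classes of floors of powers\<close>

lemma power_diff_bounds:
  fixes x y :: real
  assumes "0 \<le> x" "x \<le> y"
  shows "real l * x ^ (l - 1) * (y - x) \<le> y ^ l - x ^ l"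
    and "y ^ l - x ^ l \<le> real l * y ^ (l - 1) * (y - x)"
proof -
  have eq: "y ^ l - x ^ l = (y - x) * (\<Sum>i<l. x ^ (l - Suc i) * y ^ i)"
    by (rule power_diff_sumr2)
  have split: "z ^ (l - 1) = z ^ (l - Suc i) * z ^ i" if "i < l" for z :: real and i
    using that by (simp add: power_add[symmetric])
  have "real l * x ^ (l - 1) = (\<Sum>i<l. x ^ (l - 1))" by simp
  also have "\<dots> \<le> (\<Sum>i<l. x ^ (l - Suc i) * y ^ i)"
    using assms by (intro sum_mono, subst split) (auto intro!: mult_left_mono power_mono)
  finally show "real l * x ^ (l - 1) * (y - x) \<le> y ^ l - x ^ l"
    using assms unfolding eq by (subst mult.commute) (intro mult_left_mono, auto)
  have "(\<Sum>i<l. x ^ (l - Suc i) * y ^ i) \<le> (\<Sum>i<l. y ^ (l - 1))"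
    using assms by (intro sum_mono, subst split) (auto intro!: mult_right_mono power_mono)
  also have "\<dots> = real l * y ^ (l - 1)" by simp
  finally show "y ^ l - x ^ l \<le> real l * y ^ (l - 1) * (y - x)"
    using assms unfolding eq by (subst (2) mult.commute) (intro mult_left_mono, auto)
qed

text \<open>For a sequence that decreases from index 1 on, the sum over a progression of difference \<open>q\<close> is at
  most the \<open>q\<close>-th part of the full sum plus an upper bound \<open>w\<close> of the terms, which accounts for the first
  term of the progression: every other term is at most each of the \<open>q\<close> terms that end with it.\<close>

lemma sum_progression_le:
  fixes f :: "nat \<Rightarrow> real"
  assumes dec: "\<And>i. i \<ge> 1 \<Longrightarrow> f (Suc i) \<le> f i" and nonneg: "\<And>i. 0 \<le> f i"
    and w: "\<And>i. f i \<le> w" and q: "q \<ge> 1"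
  shows "real q * (\<Sum>k\<le>m. f (c + k * q)) \<le> real q * w + (\<Sum>i\<le>c + m * q. f i)"
proof (induction m)
  case 0
  have "0 \<le> (\<Sum>i\<le>c. f i)" by (intro sum_nonneg nonneg)
  moreover have "real q * f c \<le> real q * w" by (intro mult_left_mono w) auto
  ultimately show ?case by simp
next
  case (Suc m)
  let ?n = "c + Suc m * q"
  have anti: "f b \<le> f a" if "1 \<le> a" "a \<le> b" for a b
    using that(2,1) by (induction b rule: dec_induct) (auto intro: order_trans[OF dec])
  have "real q * f ?n = (\<Sum>i\<in>{c + m * q<..?n}. f ?n)" by simp
  also have "\<dots> \<le> (\<Sum>i\<in>{c + m * q<..?n}. f i)"
    by (intro sum_mono anti) auto
  finally have "real q * (\<Sum>k\<le>Suc m. f (c + k * q)) \<le>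
      real q * w + ((\<Sum>i\<le>c + m * q. f i) + (\<Sum>i\<in>{c + m * q<..?n}. f i))"
    using Suc.IH by (simp add: algebra_simps)
  also have "(\<Sum>i\<le>c + m * q. f i) + (\<Sum>i\<in>{c + m * q<..?n}. f i) = (\<Sum>i\<le>?n. f i)"
    by (subst sum.union_disjoint[symmetric]) (auto intro!: sum.cong)
  finally show ?case .
qed

lemma fmeasurable_lborel_bounded:
  fixes S :: "real set"
  assumes "S \<in> sets borel" "S \<subseteq> {a..b}"
  shows "S \<in> fmeasurable lborel"
  using assms by (intro fmeasurableI2[OF fmeasurable_cbox[of a b]]) (auto simp: cbox_interval)

lemma measure_lborel_le_diameter:
  fixes S :: "real set"
  assumes "S \<in> sets borel" "0 \<le> w" "\<And>a b. a \<in> S \<Longrightarrow> b \<in> S \<Longrightarrow> a \<le> b \<Longrightarrow> b - a \<le> w"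
  shows "measure lborel S \<le> w"
proof (cases "S = {}")
  case False
  then obtain s where s: "s \<in> S" by blast
  have bdd: "bdd_below S"
  proof (rule bdd_belowI)
    fix x assume "x \<in> S"
    thus "s - w \<le> x" using assms(2) assms(3)[of x s] s by (cases "x \<le> s") auto
  qed
  have "S \<subseteq> {Inf S..Inf S + w}"
  proof
    fix x assume x: "x \<in> S"
    have "x - w \<le> Inf S"
    proof (rule cInf_greatest[OF False])
      fix y assume "y \<in> S"
      thus "x - w \<le> y" using assms(2) assms(3)[of y x] x by (cases "y \<le> x") auto
    qed
    thus "x \<in> {Inf S..Inf S + w}" using cInf_lower[OF x bdd] by simp
  qed
  hence "measure lborel S \<le> measure lborel {Inf S..Inf S + w}"
    using assms(1) by (intro measure_mono_fmeasurable fmeasurable_lborel_bounded) auto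
  thus ?thesis using assms(2) by simp
qed (use assms in simp)

text \<open>On an interval \<open>J\<close>, the integer part of \<open>a ^ l\<close> lies in a given residue class modulo \<open>q\<close> with probability
  at most about \<open>1 / q\<close>. The sets where the integer part takes the successive values \<open>j\<close> are intervals;
  as the \<open>l\<close>-th root is concave, their lengths decrease with \<open>j\<close>, except that \<open>J\<close> may cut the first of
  them short. Each length is at most \<open>1 / \<alpha> ^ (l - 1)\<close>. Note that the error term does not involve \<open>q\<close>.\<close>

lemma measure_floor_power_residue_le:
  fixes J :: "real set" and \<alpha> \<beta> :: real and l q :: nat and c :: int
  assumes J: "is_interval J" "J \<subseteq> {\<alpha>..\<beta>}" and \<alpha>: "\<alpha> \<ge> 1" and l: "l \<ge> 1" and q: "q \<ge> 1"
  shows "measure lborel {a \<in> J. int q dvd \<lfloor>a ^ l\<rfloor> - c} \<le> measure lborel J / real q + 1 / \<alpha> ^ (l - 1)"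
proof (cases "J = {}")
  case True
  thus ?thesis using \<alpha> by simp
next
  case False
  have [measurable]: "J \<in> sets borel" using J(1) by (rule real_interval_borel_measurable)
  define \<Lambda> where "\<Lambda> j = {a \<in> J. \<lfloor>a ^ l\<rfloor> = j}" for j
  have \<Lambda>_sets [measurable]: "\<Lambda> j \<in> sets borel" for j
  proof -
    have "{a \<in> space borel. a \<in> J \<and> \<lfloor>a ^ l\<rfloor> = j} \<in> sets borel" by measurable
    thus ?thesis by (simp add: \<Lambda>_def)
  qed
  have \<Lambda>_fin: "\<Lambda> j \<in> fmeasurable lborel" for j
    using J(2) by (intro fmeasurable_lborel_bounded[of _ \<alpha> \<beta>]) (auto simp: \<Lambda>_def)
  have \<Lambda>_le: "measure lborel (\<Lambda> j) \<le> 1 / (real l * \<gamma> ^ (l - 1))"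
    if \<gamma>: "\<gamma> > 0" "\<And>a. a \<in> \<Lambda> j \<Longrightarrow> \<gamma> \<le> a" for j \<gamma>
  proof (rule measure_lborel_le_diameter)
    fix a b assume ab: "a \<in> \<Lambda> j" "b \<in> \<Lambda> j" "a \<le> b"
    have "\<lfloor>a ^ l\<rfloor> = \<lfloor>b ^ l\<rfloor>" using ab by (simp add: \<Lambda>_def)
    hence "b ^ l - a ^ l \<le> 1" by linarith
    moreover have "real l * a ^ (l - 1) * (b - a) \<le> b ^ l - a ^ l"
      using ab \<gamma> by (intro power_diff_bounds) force+
    moreover have "real l * \<gamma> ^ (l - 1) * (b - a) \<le> real l * a ^ (l - 1) * (b - a)"
      using ab \<gamma> by (intro mult_right_mono mult_left_mono power_mono) auto
    ultimately have "real l * \<gamma> ^ (l - 1) * (b - a) \<le> 1" by linarith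
    thus "b - a \<le> 1 / (real l * \<gamma> ^ (l - 1))" using l \<gamma> by (simp add: field_simps)
  qed (use \<gamma> in auto)
  \<comment> \<open>The first value of the integer part on \<open>J\<close>.\<close>
  define j0 where "j0 = (LEAST j. \<exists>a\<in>J. nat \<lfloor>a ^ l\<rfloor> = j)"
  have j0: "\<exists>a\<in>J. nat \<lfloor>a ^ l\<rfloor> = j0"
    unfolding j0_def by (rule LeastI_ex) (use False in auto)
  have j0_le: "int j0 \<le> \<lfloor>a ^ l\<rfloor>" if "a \<in> J" for a
  proof -
    have "j0 \<le> nat \<lfloor>a ^ l\<rfloor>" unfolding j0_def by (rule Least_le) (use that in auto)
    moreover have "1 \<le> a ^ l" using that J(2) \<alpha> by (intro one_le_power) force
    ultimately show ?thesis by linarith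
  qed
  obtain a0 where a0: "a0 \<in> J" "nat \<lfloor>a0 ^ l\<rfloor> = j0" using j0 by blast
  have a0': "1 \<le> a0 ^ l" using a0 J(2) \<alpha> by (intro one_le_power) force
  have a0_lt: "a0 ^ l < real j0 + 1" using a0 a0' by linarith
  have j0_pos: "j0 \<ge> 1" using a0 a0' by linarith
  define f where "f i = measure lborel (\<Lambda> (int (j0 + i)))" for i
  have f_w: "f i \<le> 1 / \<alpha> ^ (l - 1)" for i
  proof -
    have "f i \<le> 1 / (real l * \<alpha> ^ (l - 1))"
      unfolding f_def using \<alpha> J(2) by (intro \<Lambda>_le) (auto simp: \<Lambda>_def)
    also have "\<dots> \<le> 1 / \<alpha> ^ (l - 1)"
      using l \<alpha> by (intro divide_left_mono) auto
    finally show ?thesis .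
  qed
  have f_dec: "f (Suc i) \<le> f i" if i: "i \<ge> 1" for i
  proof (cases "\<Lambda> (int (j0 + Suc i)) = {}")
    case True
    thus ?thesis by (simp add: f_def)
  next
    case False
    then obtain b where b: "b \<in> J" "\<lfloor>b ^ l\<rfloor> = int (j0 + Suc i)" by (auto simp: \<Lambda>_def)
    define x y where "x = root l (real (j0 + i))" and "y = root l (real (j0 + Suc i))"
    have xl: "x ^ l = real (j0 + i)" and yl: "y ^ l = real (j0 + Suc i)"
      using l by (auto simp: x_def y_def)
    have xy: "0 < x" "x \<le> y" using l j0_pos by (auto simp: x_def y_def)
    \<comment> \<open>An interior cell lies in \<open>J\<close> completely, since \<open>J\<close> contains points on both sides of it.\<close>
    have "{x..<y} \<subseteq> \<Lambda> (int (j0 + i))"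
    proof
      fix z assume z: "z \<in> {x..<y}"
      have zl: "real (j0 + i) \<le> z ^ l" "z ^ l < real (j0 + Suc i)"
        unfolding xl[symmetric] yl[symmetric] using z xy l
        by (auto intro!: power_mono power_strict_mono)
      have "a0 ^ l \<le> z ^ l" using a0_lt zl i by linarith
      moreover have "z ^ l \<le> b ^ l" using b zl by linarith
      moreover have "0 \<le> a0" "0 \<le> z" "0 \<le> b" using a0 b z xy J(2) \<alpha> by force+
      ultimately have "a0 \<le> z" "z \<le> b" using l by (auto simp: power_mono_iff)
      hence "z \<in> J" using J(1) a0 b unfolding is_interval_1 by blast
      moreover have "\<lfloor>z ^ l\<rfloor> = int (j0 + i)" using zl by linarith
      ultimately show "z \<in> \<Lambda> (int (j0 + i))" by (simp add: \<Lambda>_def)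
    qed
    hence "measure lborel {x..<y} \<le> f i"
      unfolding f_def by (intro measure_mono_fmeasurable \<Lambda>_fin) auto
    hence le1: "y - x \<le> f i" using xy by simp
    have "1 = y ^ l - x ^ l" by (simp add: xl yl)
    also have "\<dots> \<le> real l * y ^ (l - 1) * (y - x)"
      using xy by (intro power_diff_bounds) auto
    finally have "1 / (real l * y ^ (l - 1)) \<le> y - x"
      using xy l by (simp add: field_simps)
    moreover have "f (Suc i) \<le> 1 / (real l * y ^ (l - 1))"
      unfolding f_def
    proof (rule \<Lambda>_le)
      fix a assume a: "a \<in> \<Lambda> (int (j0 + Suc i))"
      hence "y ^ l \<le> a ^ l" unfolding yl \<Lambda>_def by (simp add: floor_eq_iff)
      moreover have "0 \<le> a" using a J(2) \<alpha> by (force simp: \<Lambda>_def)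
      ultimately show "y \<le> a" using xy l by (simp add: power_mono_iff)
    qed (use xy in auto)
    ultimately show ?thesis using le1 by linarith
  qed
  define c' where "c' = nat ((c - int j0) mod int q)"
  define m where "m = nat \<lfloor>\<beta> ^ l\<rfloor>"
  have "{a \<in> J. int q dvd \<lfloor>a ^ l\<rfloor> - c} \<subseteq> (\<Union>k\<in>{..m}. \<Lambda> (int (j0 + (c' + k * q))))"
  proof
    fix a assume a: "a \<in> {a \<in> J. int q dvd \<lfloor>a ^ l\<rfloor> - c}"
    define i where "i = nat (\<lfloor>a ^ l\<rfloor> - int j0)"
    have i: "\<lfloor>a ^ l\<rfloor> = int (j0 + i)" using j0_le[of a] a by (simp add: i_def)
    have "int i mod int q = (c - int j0) mod int q"
      unfolding mod_eq_dvd_iff using a i by (simp add: algebra_simps)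
    hence c': "c' = i mod q" unfolding c'_def by (simp add: zmod_int[symmetric])
    have "a ^ l \<le> \<beta> ^ l" using a J(2) \<alpha> by (intro power_mono) force+
    hence "\<lfloor>a ^ l\<rfloor> \<le> \<lfloor>\<beta> ^ l\<rfloor>" by (rule floor_mono)
    hence "i \<le> m" by (simp add: i_def m_def)
    moreover have "i div q \<le> i" by simp
    ultimately have "i div q \<le> m" by linarith
    moreover have "a \<in> \<Lambda> (int (j0 + (c' + (i div q) * q)))" using a i by (simp add: \<Lambda>_def c')
    ultimately show "a \<in> (\<Union>k\<in>{..m}. \<Lambda> (int (j0 + (c' + k * q))))" by blast
  qed
  moreover have "{a \<in> J. int q dvd \<lfloor>a ^ l\<rfloor> - c} \<in> sets borel"
  proof -
    have "{a \<in> space borel. a \<in> J \<and> int q dvd \<lfloor>a ^ l\<rfloor> - c} \<in> sets borel" by measurable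
    thus ?thesis by simp
  qed
  ultimately have "measure lborel {a \<in> J. int q dvd \<lfloor>a ^ l\<rfloor> - c} \<le>
      measure lborel (\<Union>k\<in>{..m}. \<Lambda> (int (j0 + (c' + k * q))))"
    using J(2) by (intro measure_mono_fmeasurable fmeasurable_lborel_bounded[of _ \<alpha> \<beta>])
                  (auto simp: \<Lambda>_def)
  also have "\<dots> \<le> (\<Sum>k\<le>m. f (c' + k * q))"
    unfolding f_def by (intro measure_UNION_le) auto
  finally have "real q * measure lborel {a \<in> J. int q dvd \<lfloor>a ^ l\<rfloor> - c} \<le>
      real q * (\<Sum>k\<le>m. f (c' + k * q))" by (intro mult_left_mono) auto
  also have "\<dots> \<le> real q * (1 / \<alpha> ^ (l - 1)) + (\<Sum>i\<le>c' + m * q. f i)"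
    using f_dec f_w q by (intro sum_progression_le) (auto simp: f_def)
  also have "(\<Sum>i\<le>c' + m * q. f i) = measure lborel (\<Union>i\<in>{..c' + m * q}. \<Lambda> (int (j0 + i)))"
    unfolding f_def using \<Lambda>_fin
    by (intro measure_finite_Union[symmetric])
       (auto simp: disjoint_family_on_def \<Lambda>_def fmeasurable_def dest: less_imp_neq)
  also have "\<dots> \<le> measure lborel J"
    using J(2) by (intro measure_mono_fmeasurable fmeasurable_lborel_bounded[of J \<alpha> \<beta>])
                  (auto simp: \<Lambda>_def)
  finally show ?thesis using q by (simp add: field_simps)
qed

lemma sum_inverse_le:
  assumes "n \<ge> 1"
  shows "(\<Sum>g\<in>{1..n}. 1 / real g) \<le> 1 + ln (real n)"
  using assms
proof (induction n rule: dec_induct)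
  case (step n)
  have "1 / real (Suc n) \<le> ln (real (Suc n)) - ln (real n)"
  proof -
    have "ln (real n / real (Suc n)) \<le> real n / real (Suc n) - 1"
      using step by (intro ln_le_minus_one) auto
    also have "\<dots> = - (1 / real (Suc n))" by (simp add: field_simps)
    finally show ?thesis using step by (simp add: ln_div)
  qed
  thus ?case using step by simp
qed simp

text \<open>The same bound when the prescribed residue \<open>h a\<close> depends on \<open>a\<close>, but only through a monotone
  integer-valued function \<open>G\<close> of size at most about \<open>a ^ L\<close> with \<open>L < l\<close>. The interval splits into the level sets of
  \<open>G\<close>, which are intervals on which \<open>h\<close> is constant. On the level set of \<open>g\<close> one has
  \<open>a ^ L \<ge> g / 3\<close>, so that the error terms form a harmonic sum.\<close>

lemma measure_floor_power_collision_le: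
  fixes A B :: real and G h :: "real \<Rightarrow> int" and L l q :: nat
  assumes AB: "1 \<le> A" "A \<le> B" and L: "1 \<le> L" "L < l" and q: "q \<ge> 1"
    and mono: "\<And>a b. A \<le> a \<Longrightarrow> a \<le> b \<Longrightarrow> b \<le> B \<Longrightarrow> G a \<le> G b"
    and G1: "\<And>a. a \<in> {A..B} \<Longrightarrow> 1 \<le> G a"
    and G2: "\<And>a. a \<in> {A..B} \<Longrightarrow> real_of_int (G a) \<le> 3 * a ^ L"
    and h: "\<And>a b. a \<in> {A..B} \<Longrightarrow> b \<in> {A..B} \<Longrightarrow> G a = G b \<Longrightarrow> h a = h b"
  shows "measure lborel {a \<in> {A..B}. int q dvd \<lfloor>a ^ l\<rfloor> - h a} \<le>
           (B - A) / real q + 3 / A ^ (l - 1 - L) * (1 + ln (3 * B ^ L))"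
proof -
  define n where "n = nat \<lfloor>3 * B ^ L\<rfloor>"
  define J where "J g = {a \<in> {A..B}. G a = int g}" for g
  define S where "S g = {a \<in> J g. int q dvd \<lfloor>a ^ l\<rfloor> - h a}" for g
  have J_int: "is_interval (J g)" for g
    unfolding is_interval_1 J_def
  proof (safe, goal_cases)
    case (1 a b x)
    thus ?case by simp
  next
    case (2 a b x)
    have "G a \<le> G x" "G x \<le> G b" using 2 mono[of a x] mono[of x b] by auto
    thus ?case using 2 by simp
  qed
  have J_sets [measurable]: "J g \<in> sets borel" for g by (intro real_interval_borel_measurable J_int)
  have S_eq: "\<exists>c. S g = {a \<in> J g. int q dvd \<lfloor>a ^ l\<rfloor> - c}" for g
  proof (cases "J g = {}")
    case False
    then obtain b where "b \<in> J g" by blast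
    hence "h a = h b" if "a \<in> J g" for a using that by (intro h) (auto simp: J_def)
    hence "S g = {a \<in> J g. int q dvd \<lfloor>a ^ l\<rfloor> - h b}"
      unfolding S_def by (intro Collect_cong conj_cong refl) simp
    thus ?thesis by blast
  qed (auto simp: S_def)
  have S_sets: "S g \<in> sets borel" for g
  proof -
    obtain c where c: "S g = {a \<in> J g. int q dvd \<lfloor>a ^ l\<rfloor> - c}" using S_eq by blast
    have "{a \<in> space borel. a \<in> J g \<and> int q dvd \<lfloor>a ^ l\<rfloor> - c} \<in> sets borel" by measurable
    thus ?thesis by (simp add: c)
  qed
  have S_le: "measure lborel (S g) \<le> measure lborel (J g) / real q + 3 / A ^ (l - 1 - L) * (1 / real g)"
    if g: "g \<ge> 1" for g
  proof -
    define \<alpha> where "\<alpha> = max A (root L (real g / 3))"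
    have \<alpha>: "\<alpha> \<ge> A" "\<alpha> \<ge> 1" using AB by (auto simp: \<alpha>_def)
    have "J g \<subseteq> {\<alpha>..B}"
    proof
      fix a assume a: "a \<in> J g"
      hence "real g / 3 \<le> a ^ L" using G2[of a] by (auto simp: J_def)
      hence "root L (real g / 3) \<le> root L (a ^ L)" using L by simp
      also have "\<dots> = a" using a AB L by (intro real_root_power_cancel) (auto simp: J_def)
      finally show "a \<in> {\<alpha>..B}" using a by (simp add: \<alpha>_def J_def)
    qed
    moreover obtain c where "S g = {a \<in> J g. int q dvd \<lfloor>a ^ l\<rfloor> - c}" using S_eq by blast
    ultimately have "measure lborel (S g) \<le> measure lborel (J g) / real q + 1 / \<alpha> ^ (l - 1)"
      using measure_floor_power_residue_le[OF J_int _ \<alpha>(2) _ q] L by simp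
    also have "1 / \<alpha> ^ (l - 1) \<le> 1 / ((real g / 3) * A ^ (l - 1 - L))"
    proof (rule divide_left_mono)
      have "real g / 3 = root L (real g / 3) ^ L" using L by simp
      also have "\<dots> \<le> \<alpha> ^ L" using L by (intro power_mono) (auto simp: \<alpha>_def)
      finally have "real g / 3 * A ^ (l - 1 - L) \<le> \<alpha> ^ L * \<alpha> ^ (l - 1 - L)"
        using AB \<alpha> by (intro mult_mono power_mono) auto
      also have "\<dots> = \<alpha> ^ (l - 1)" using L by (simp add: power_add[symmetric])
      finally show "real g / 3 * A ^ (l - 1 - L) \<le> \<alpha> ^ (l - 1)" .
      show "0 < \<alpha> ^ (l - 1) * (real g / 3 * A ^ (l - 1 - L))" using AB \<alpha> g by simp
    qed simp
    finally show ?thesis by (simp add: mult.commute)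
  qed
  have range: "G a \<ge> 1 \<and> nat (G a) \<le> n" if "a \<in> {A..B}" for a
  proof -
    have "real_of_int (G a) \<le> 3 * a ^ L" using G2[OF that] .
    also have "\<dots> \<le> 3 * B ^ L" using that AB by (intro mult_left_mono power_mono) auto
    finally have "G a \<le> \<lfloor>3 * B ^ L\<rfloor>" by linarith
    thus ?thesis using G1[OF that] by (simp add: n_def)
  qed
  have fin: "S g \<in> fmeasurable lborel" "J g \<in> fmeasurable lborel" for g
    by (intro fmeasurable_lborel_bounded[of _ A B] S_sets J_sets; auto simp: S_def J_def)+
  have Bp: "1 \<le> B ^ L" using AB by (intro one_le_power) auto
  have n1: "n \<ge> 1" "real n \<le> 3 * B ^ L" using Bp by (auto simp: n_def) linarith
  have "{a \<in> {A..B}. int q dvd \<lfloor>a ^ l\<rfloor> - h a} = (\<Union>g\<in>{1..n}. S g)"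
  proof (intro equalityI subsetI)
    fix a assume a: "a \<in> {a \<in> {A..B}. int q dvd \<lfloor>a ^ l\<rfloor> - h a}"
    hence "a \<in> S (nat (G a))" "nat (G a) \<in> {1..n}" using range[of a] by (auto simp: S_def J_def)
    thus "a \<in> (\<Union>g\<in>{1..n}. S g)" by blast
  qed (auto simp: S_def J_def)
  hence "measure lborel {a \<in> {A..B}. int q dvd \<lfloor>a ^ l\<rfloor> - h a} \<le> (\<Sum>g\<in>{1..n}. measure lborel (S g))"
    using S_sets by (auto intro!: measure_UNION_le)
  also have "\<dots> \<le> (\<Sum>g\<in>{1..n}. measure lborel (J g) / real q + 3 / A ^ (l - 1 - L) * (1 / real g))"
    by (intro sum_mono S_le) auto
  also have "\<dots> = (\<Sum>g\<in>{1..n}. measure lborel (J g)) / real q +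
                   3 / A ^ (l - 1 - L) * (\<Sum>g\<in>{1..n}. 1 / real g)"
    by (simp only: sum.distrib sum_divide_distrib sum_distrib_left)
  also have "(\<Sum>g\<in>{1..n}. measure lborel (J g)) = measure lborel (\<Union>g\<in>{1..n}. J g)"
    using fin by (intro measure_finite_Union[symmetric])
                 (auto simp: disjoint_family_on_def J_def fmeasurable_def dest: less_imp_neq)
  also have "\<dots> \<le> measure lborel {A..B}"
  proof (rule measure_mono_fmeasurable)
    show "(\<Union>g\<in>{1..n}. J g) \<in> sets lborel" by measurable
    show "{A..B} \<in> fmeasurable lborel" by (rule fmeasurable_lborel_bounded) auto
  qed (auto simp: J_def)
  also have "measure lborel {A..B} = B - A" using AB by simp
  also have "(\<Sum>g\<in>{1..n}. 1 / real g) \<le> 1 + ln (real n)" by (rule sum_inverse_le[OF n1(1)])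
  also have "ln (real n) \<le> ln (3 * B ^ L)" using n1 by (intro ln_mono) auto
  finally show ?thesis using AB q by (simp add: divide_right_mono mult_left_mono)
qed

section \<open>The residue variance for almost every base\<close>

lemma sum_inverse_dyadic_le: "(\<Sum>d\<in>{2..2 ^ k}. 1 / real d) \<le> real k + 1"
proof -
  have "(\<Sum>d\<in>{2..2 ^ k}. 1 / real d) \<le> (\<Sum>d\<in>{1..2 ^ k}. 1 / real d)"
    by (intro sum_mono2) auto
  also have "\<dots> \<le> 1 + ln (real (2 ^ k))" by (intro sum_inverse_le) auto
  also have "ln (real (2 ^ k)) = real k * ln 2" by (simp add: ln_realpow)
  also have "\<dots> \<le> real k * 1" using ln2_le_25_over_36 by (intro mult_left_mono) auto
  finally show ?thesis by simp
qed

text \<open>If any two distinct shifts collide modulo \<open>q\<close> with probability essentially at most \<open>1 / q\<close>, then the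
  mean of the variance is governed by the diagonal alone, that is, it is of the order of the number
  of shifts.\<close>

lemma integral_residue_variance_le:
  fixes v :: "'i \<Rightarrow> real \<Rightarrow> int" and A B \<delta> :: real
  assumes AB: "A \<le> B" and I: "finite I" and q: "q \<ge> 1" and \<delta>: "\<delta> \<ge> 0"
    and meas [measurable]: "\<And>i. v i \<in> borel \<rightarrow>\<^sub>M count_space UNIV"
    and coll: "\<And>i j. i \<in> I \<Longrightarrow> j \<in> I \<Longrightarrow> i \<noteq> j \<Longrightarrow>
      measure lborel {a \<in> {A..B}. int q dvd v i a - v j a} \<le> (B - A) / real q + \<delta>"
  defines "f \<equiv> \<lambda>a. indicator {A..B} a * residue_variance I (\<lambda>i. v i a) q"
  shows "integrable lborel f"
    and "(LINT a|lborel. f a) \<le> real (card I) * (B - A) + (real (card I))\<^sup>2 * \<delta>"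
proof -
  define S where "S i j = {a \<in> {A..B}. int q dvd v i a - v j a}" for i j
  have S_fin: "S i j \<in> fmeasurable lborel" for i j
  proof -
    have "{a \<in> space borel. a \<in> {A..B} \<and> int q dvd v i a - v j a} \<in> sets borel" by measurable
    thus ?thesis by (intro fmeasurable_lborel_bounded[of _ A B]) (auto simp: S_def)
  qed
  have Iv_fin: "{A..B} \<in> fmeasurable lborel" by (rule fmeasurable_lborel_bounded) auto
  have f_eq: "f = (\<lambda>a. (\<Sum>i\<in>I. \<Sum>j\<in>I. indicator (S i j) a)
                     - (real (card I))\<^sup>2 / real q * indicator {A..B} a)"
  proof
    fix a
    show "f a = (\<Sum>i\<in>I. \<Sum>j\<in>I. indicator (S i j) a)
                     - (real (card I))\<^sup>2 / real q * indicator {A..B} a"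
      using residue_variance_eq[OF I, of q "\<lambda>i. v i a"] q
      by (cases "a \<in> {A..B}") (auto simp: f_def S_def indicator_def of_bool_def)
  qed
  have int_S: "integrable lborel (indicat_real (S i j))" for i j
    using S_fin by (intro integrable_real_indicator) (auto simp: fmeasurable_def)
  have int_Iv: "integrable lborel (indicat_real {A..B})"
    using Iv_fin by (intro integrable_real_indicator) (auto simp: fmeasurable_def)
  show "integrable lborel f"
    unfolding f_eq by (intro Bochner_Integration.integrable_diff Bochner_Integration.integrable_sum
        integrable_mult_right int_S int_Iv)
  have "(LINT a|lborel. f a) = (\<Sum>i\<in>I. \<Sum>j\<in>I. measure lborel (S i j))
           - (real (card I))\<^sup>2 / real q * measure lborel {A..B}"
    unfolding f_eq using int_S int_Iv
    by (simp add: Bochner_Integration.integral_diff Bochner_Integration.integral_sum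
        Bochner_Integration.integrable_sum)
  also have "(\<Sum>i\<in>I. \<Sum>j\<in>I. measure lborel (S i j)) \<le>
      (\<Sum>i\<in>I. \<Sum>j\<in>I. ((B - A) / real q + \<delta>) + (if i = j then B - A else 0))"
  proof (intro sum_mono)
    fix i j assume ij: "i \<in> I" "j \<in> I"
    show "measure lborel (S i j) \<le> ((B - A) / real q + \<delta>) + (if i = j then B - A else 0)"
    proof (cases "i = j")
      case True
      have "measure lborel (S i j) \<le> measure lborel {A..B}"
        using S_fin Iv_fin by (intro measure_mono_fmeasurable) (auto simp: S_def fmeasurable_def)
      also have "\<dots> = B - A" using AB by simp
      finally have "measure lborel (S i j) \<le> B - A" .
      moreover have "0 \<le> (B - A) / real q" using AB by simp
      ultimately show ?thesis using True \<delta> by simp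
    qed (use coll[OF ij] in \<open>auto simp: S_def\<close>)
  qed
  also have "\<dots> = (real (card I))\<^sup>2 * ((B - A) / real q + \<delta>) + real (card I) * (B - A)"
    using I by (simp add: sum.distrib power2_eq_square algebra_simps)
  finally show "(LINT a|lborel. f a) \<le> real (card I) * (B - A) + (real (card I))\<^sup>2 * \<delta>"
    using AB by (simp add: algebra_simps)
qed

text \<open>The mean of the sum below is at most of order \<open>(k + 1) * card (I k)\<close>, hence by the Markov inequality the
  opposite inequality holds on a set of measure at most of order \<open>1 / (k + 1)\<^sup>2\<close>, and the first Borel-Cantelli
  lemma applies.\<close>

lemma AE_eventually_residue_variance_less:
  fixes v :: "nat \<Rightarrow> 'i \<Rightarrow> real \<Rightarrow> int" and I :: "nat \<Rightarrow> 'i set" and A B D :: real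
  assumes AB: "A \<le> B" and I: "\<And>k. finite (I k)" "\<And>k. I k \<noteq> {}" and D: "D \<ge> 0"
    and meas: "\<And>k i. v k i \<in> borel \<rightarrow>\<^sub>M count_space UNIV"
    and coll: "\<And>k i j q. i \<in> I k \<Longrightarrow> j \<in> I k \<Longrightarrow> i \<noteq> j \<Longrightarrow> q \<ge> 1 \<Longrightarrow>
      measure lborel {a \<in> {A..B}. int q dvd v k i a - v k j a} \<le>
        (B - A) / real q + D / real (card (I k))"
  shows "AE a in lborel. a \<in> {A..B} \<longrightarrow> (\<forall>\<^sub>F k in sequentially.
      (\<Sum>d\<in>{2..2 ^ k}. residue_variance (I k) (\<lambda>i. v k i a) (d\<^sup>2) / real d)
        < real (card (I k)) * (real k + 1) ^ 3)"
proof -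
  define T where "T k = real (card (I k))" for k
  define Y where "Y k a = (\<Sum>d\<in>{2..2 ^ k}. indicator {A..B} a *
      residue_variance (I k) (\<lambda>i. v k i a) (d\<^sup>2) / real d)" for k a
  define t where "t k = T k * (real k + 1) ^ 3" for k
  define Z where "Z k = {a \<in> space lborel. Y k a \<ge> t k}" for k
  have T: "T k > 0" for k using I by (simp add: T_def card_gt_0_iff)
  have t: "t k > 0" for k using T by (simp add: t_def)
  have var_int: "integrable lborel (\<lambda>a. indicator {A..B} a * residue_variance (I k) (\<lambda>i. v k i a) (d\<^sup>2))"
    and var_le: "(LINT a|lborel. indicator {A..B} a * residue_variance (I k) (\<lambda>i. v k i a) (d\<^sup>2))
                  \<le> T k * (B - A + D)" if d: "d \<ge> 2" for d k
  proof -
    have d': "1 \<le> d\<^sup>2" using d by simp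
    note * = integral_residue_variance_le[OF AB I(1) d' _ meas coll[OF _ _ _ d']]
    show "integrable lborel (\<lambda>a. indicator {A..B} a * residue_variance (I k) (\<lambda>i. v k i a) (d\<^sup>2))"
      by (rule *(1)) (use D in auto)
    have "(LINT a|lborel. indicator {A..B} a * residue_variance (I k) (\<lambda>i. v k i a) (d\<^sup>2))
             \<le> T k * (B - A) + (T k)\<^sup>2 * (D / T k)"
      unfolding T_def by (rule *(2)) (use D in auto)
    also have "\<dots> = T k * (B - A + D)"
      using T[of k] by (simp add: power2_eq_square algebra_simps)
    finally show "(LINT a|lborel. indicator {A..B} a * residue_variance (I k) (\<lambda>i. v k i a) (d\<^sup>2))
             \<le> T k * (B - A + D)" .
  qed
  have Y_int: "integrable lborel (Y k)" for k
    unfolding Y_def by (intro Bochner_Integration.integrable_sum integrable_divide var_int) auto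
  have Y_nonneg: "Y k a \<ge> 0" for k a
    unfolding Y_def by (intro sum_nonneg divide_nonneg_nonneg mult_nonneg_nonneg
        residue_variance_nonneg) auto
  have Y_le: "(LINT a|lborel. Y k a) \<le> (real k + 1) * (T k * (B - A + D))" for k
  proof -
    have "(LINT a|lborel. Y k a) = (\<Sum>d\<in>{2..2 ^ k}.
        (LINT a|lborel. indicator {A..B} a * residue_variance (I k) (\<lambda>i. v k i a) (d\<^sup>2)) / real d)"
      unfolding Y_def using var_int by (subst Bochner_Integration.integral_sum) auto
    also have "\<dots> \<le> (\<Sum>d\<in>{2..2 ^ k}. T k * (B - A + D) / real d)"
      by (intro sum_mono divide_right_mono var_le) auto
    also have "\<dots> = (\<Sum>d\<in>{2..2 ^ k}. 1 / real d) * (T k * (B - A + D))"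
      by (simp add: sum_distrib_right)
    also have "\<dots> \<le> (real k + 1) * (T k * (B - A + D))"
      using AB D T[of k] by (intro mult_right_mono sum_inverse_dyadic_le) auto
    finally show ?thesis .
  qed
  have Z_sets: "Z k \<in> sets lborel" for k
    unfolding Z_def using Y_int[of k] by measurable
  have Z_sub: "Z k \<subseteq> {A..B}" for k
  proof
    fix a assume a: "a \<in> Z k"
    show "a \<in> {A..B}"
    proof (rule ccontr)
      assume "a \<notin> {A..B}"
      hence "Y k a = 0" by (simp add: Y_def)
      thus False using a t[of k] by (simp add: Z_def)
    qed
  qed
  have Z_fin: "Z k \<in> fmeasurable lborel" for k
    using Z_sets Z_sub by (intro fmeasurable_lborel_bounded) auto
  have Z_le: "measure lborel (Z k) \<le> (B - A + D) * (1 / (real (Suc k))\<^sup>2)" for k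
  proof -
    have "measure lborel (Z k) \<le> (LINT a|lborel. Y k a) / t k"
      unfolding Z_def using Y_int Y_nonneg t by (intro integral_Markov_inequality_measure[of _ _ "{}"]) auto
    also have "\<dots> \<le> (real k + 1) * (T k * (B - A + D)) / t k"
      using Y_le t[of k] by (intro divide_right_mono) auto
    also have "\<dots> = (B - A + D) * (1 / (real (Suc k))\<^sup>2)"
    proof -
      have "(s * (T k * c)) / (T k * s ^ 3) = c * (1 / s\<^sup>2)" if "s > 0" for s c :: real
        using T[of k] that by (simp add: power2_eq_square power3_eq_cube)
      from this[of "real k + 1" "B - A + D"] show ?thesis by (simp add: t_def add.commute)
    qed
    finally show ?thesis .
  qed
  have "AE a in lborel. \<forall>\<^sub>F k in sequentially. a \<in> space lborel - Z k"
  proof (rule borel_cantelli_AE1)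
    have "summable (\<lambda>k. 1 / (real (Suc k))\<^sup>2)"
      using inverse_power_summable[of 2, where 'a = real]
      by (subst summable_Suc_iff) (simp add: inverse_eq_divide)
    hence "summable (\<lambda>k. (B - A + D) * (1 / (real (Suc k))\<^sup>2))" by (rule summable_mult)
    thus "summable (\<lambda>k. measure lborel (Z k))"
      by (rule summable_comparison_test'[where N = 0]) (use Z_le in auto)
  qed (use Z_sets Z_fin in \<open>auto simp: fmeasurable_def\<close>)
  thus ?thesis
  proof (rule AE_mp, intro AE_I2 impI)
    fix a assume ev: "\<forall>\<^sub>F k in sequentially. a \<in> space lborel - Z k" and a: "a \<in> {A..B}"
    show "\<forall>\<^sub>F k in sequentially.
      (\<Sum>d\<in>{2..2 ^ k}. residue_variance (I k) (\<lambda>i. v k i a) (d\<^sup>2) / real d)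
        < real (card (I k)) * (real k + 1) ^ 3"
      using ev by eventually_elim (use a in \<open>auto simp: Z_def Y_def t_def T_def\<close>)
  qed
qed

section \<open>Lacunary shifts\<close>

lemma floor_power_mono:
  fixes a b :: real
  assumes "0 \<le> a" "a \<le> b"
  shows "\<lfloor>a ^ m\<rfloor> \<le> \<lfloor>b ^ m\<rfloor>"
  using assms by (intro floor_mono power_mono)

lemma floor_power_ge_1:
  fixes a :: real
  assumes "1 \<le> a"
  shows "1 \<le> \<lfloor>a ^ m\<rfloor>"
  using one_le_power[OF assms, of m] by simp

lemma floor_power_le_power:
  fixes a :: real
  assumes "1 \<le> a" "m \<le> n"
  shows "real_of_int \<lfloor>a ^ m\<rfloor> \<le> a ^ n"
  using power_increasing[OF assms(2,1)] of_int_floor_le[of "a ^ m"] by linarith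

text \<open>The common difference of the exponents used at scale \<open>k\<close>. With \<open>16 \<le> a ^ C\<close> it makes \<open>a ^ gap C k\<close> at
  least \<open>16 ^ (k + 1)\<close>, enough for the integer parts of powers with exponents in different multiples
  of the gap to behave like independent residues.\<close>

definition gap :: "nat \<Rightarrow> nat \<Rightarrow> nat" where
  "gap C k = C * Suc k"

text \<open>Index set of the shifts of the first form: the index \<open>t\<close> stands for the exponent \<open>gap C k * t\<close>, so
  the exponents at scale \<open>k\<close> are the first \<open>2 ^ k\<close> multiples of the gap.\<close>

definition single_index :: "nat \<Rightarrow> nat set" where
  "single_index k = {1..2 ^ k}"

definition single_shift :: "nat \<Rightarrow> nat \<Rightarrow> nat \<Rightarrow> real \<Rightarrow> int" where
  "single_shift C k t a = \<lfloor>a ^ (gap C k * t)\<rfloor>"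

text \<open>Index set of the shifts of the second form, where multiples of the gap are again represented by their
  factors: the smaller exponent is one of the first \<open>2 ^ k\<close> multiples of the gap, the
  larger one is among the next \<open>2 ^ k\<close>. Thus there are \<open>4 ^ k\<close> pairs, and the two exponents never
  coincide.\<close>

definition pair_index :: "nat \<Rightarrow> (nat \<times> nat) set" where
  "pair_index k = {1..2 ^ k} \<times> {2 ^ k + 1..2 * 2 ^ k}"

definition pair_shift :: "nat \<Rightarrow> nat \<Rightarrow> nat \<times> nat \<Rightarrow> real \<Rightarrow> int" where
  "pair_shift C k p a = \<lfloor>a ^ (gap C k * fst p)\<rfloor> + \<lfloor>a ^ (gap C k * snd p)\<rfloor>"

text \<open>The constant in the error term \<open>collision_const A B C / 4 ^ k\<close> of all collision probabilities at scale
  \<open>k\<close>, for bases between \<open>A\<close> and \<open>B\<close>.\<close>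

definition collision_const :: "real \<Rightarrow> real \<Rightarrow> nat \<Rightarrow> real" where
  "collision_const A B C = 3 * A * (1 + ln 3 + 2 * real C * ln B)"

lemma collision_const_nonneg:
  assumes "1 \<le> A" "A \<le> B"
  shows "0 \<le> collision_const A B C"
  using assms by (simp add: collision_const_def)

lemma Suc_le_two_power: "real (Suc k) \<le> 2 ^ k"
  by (induction k) auto

lemma collision_error_le:
  fixes A B :: real and C k L l :: nat
  assumes A: "1 \<le> A" "A \<le> B" and C: "1 \<le> C" "16 \<le> A ^ C"
    and L: "L \<le> gap C k * (2 * 2 ^ k)" and l: "L + gap C k \<le> l"
  shows "3 / A ^ (l - 1 - L) * (1 + ln (3 * B ^ L)) \<le> collision_const A B C / 4 ^ k"
proof -
  have gap: "gap C k \<ge> 1" using C by (simp add: gap_def)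
  have "16 ^ Suc k \<le> (A ^ C) ^ Suc k" using C by (intro power_mono) auto
  also have "\<dots> = A ^ gap C k" by (simp only: gap_def power_mult)
  also have "\<dots> = A * A ^ (gap C k - 1)" using gap by (cases "gap C k") auto
  also have "A ^ (gap C k - 1) \<le> A ^ (l - 1 - L)"
    using A l by (intro power_increasing) auto
  finally have pow: "16 ^ Suc k \<le> A * A ^ (l - 1 - L)" using A by simp
  have "real L \<le> real (gap C k * (2 * 2 ^ k))" using L by (simp only: of_nat_le_iff)
  also have "\<dots> = 2 * real C * (real (Suc k) * 2 ^ k)"
    by (simp add: gap_def algebra_simps)
  also have "\<dots> \<le> 2 * real C * (2 ^ k * 2 ^ k)"
    using Suc_le_two_power by (intro mult_left_mono mult_right_mono) auto
  also have "(2::real) ^ k * 2 ^ k = 4 ^ k" by (simp flip: power_mult_distrib)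
  finally have L': "real L \<le> 2 * real C * 4 ^ k" .
  have "1 + ln (3 * B ^ L) = 1 + ln 3 + real L * ln B"
    using A by (simp add: ln_mult ln_realpow)
  also have "\<dots> \<le> (1 + ln 3) * 4 ^ k + (2 * real C * 4 ^ k) * ln B"
  proof (intro add_mono mult_right_mono L')
    show "1 + ln 3 \<le> (1 + ln 3) * (4::real) ^ k"
      using mult_left_mono[of 1 "(4::real) ^ k" "1 + ln 3"] by simp
  qed (use A in auto)
  also have "\<dots> = 4 ^ k * (1 + ln 3 + 2 * real C * ln B)" by (simp add: algebra_simps)
  finally have ln_le: "1 + ln (3 * B ^ L) \<le> 4 ^ k * (1 + ln 3 + 2 * real C * ln B)" .
  have "1 \<le> B ^ L" using A by (intro one_le_power) auto
  hence ln_nn: "0 \<le> 1 + ln (3 * B ^ L)" using ln_ge_zero[of "3 * B ^ L"] by linarith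
  have "3 / A ^ (l - 1 - L) = 3 * A / (A * A ^ (l - 1 - L))" using A by simp
  also have "\<dots> \<le> 3 * A / 16 ^ Suc k"
    using pow A by (intro divide_left_mono) auto
  also have "\<dots> \<le> 3 * A / 16 ^ k"
    using A by (intro divide_left_mono) auto
  finally have "3 / A ^ (l - 1 - L) * (1 + ln (3 * B ^ L)) \<le>
      3 * A / 16 ^ k * (4 ^ k * (1 + ln 3 + 2 * real C * ln B))"
    using ln_le A ln_nn by (intro mult_mono) auto
  also have "(16::real) ^ k = 4 ^ k * 4 ^ k" by (simp flip: power_mult_distrib)
  finally show ?thesis by (simp add: collision_const_def)
qed

text \<open>The collision bound for the exponents \<open>gap C k * t\<close> and lower multiples of the gap.\<close>

lemma floor_power_collision_gap_le:
  fixes A B :: real and G h :: "real \<Rightarrow> int" and C k q s t :: nat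
  assumes A: "1 \<le> A" "A \<le> B" and C: "1 \<le> C" "16 \<le> A ^ C" and q: "q \<ge> 1"
    and s: "1 \<le> s" "s < t" "t \<le> 2 * 2 ^ k"
    and mono: "\<And>a b. A \<le> a \<Longrightarrow> a \<le> b \<Longrightarrow> b \<le> B \<Longrightarrow> G a \<le> G b"
    and G1: "\<And>a. a \<in> {A..B} \<Longrightarrow> 1 \<le> G a"
    and G2: "\<And>a. a \<in> {A..B} \<Longrightarrow> real_of_int (G a) \<le> 3 * a ^ (gap C k * s)"
    and h: "\<And>a b. a \<in> {A..B} \<Longrightarrow> b \<in> {A..B} \<Longrightarrow> G a = G b \<Longrightarrow> h a = h b"
  shows "measure lborel {a \<in> {A..B}. int q dvd \<lfloor>a ^ (gap C k * t)\<rfloor> - h a} \<le>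
           (B - A) / real q + collision_const A B C / 4 ^ k"
proof -
  have gap: "gap C k \<ge> 1" using C by (simp add: gap_def)
  have "gap C k * s + gap C k = gap C k * Suc s" by simp
  also have "\<dots> \<le> gap C k * t" using s by (intro mult_le_mono2) auto
  finally have st: "gap C k * s + gap C k \<le> gap C k * t" .
  have "measure lborel {a \<in> {A..B}. int q dvd \<lfloor>a ^ (gap C k * t)\<rfloor> - h a} \<le>
      (B - A) / real q + 3 / A ^ (gap C k * t - 1 - gap C k * s) * (1 + ln (3 * B ^ (gap C k * s)))"
  proof (rule measure_floor_power_collision_le[OF A _ _ q mono G1 G2 h])
    show "1 \<le> gap C k * s" using gap s by simp
    show "gap C k * s < gap C k * t" using gap st by linarith
  qed
  also have "3 / A ^ (gap C k * t - 1 - gap C k * s) * (1 + ln (3 * B ^ (gap C k * s)))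
      \<le> collision_const A B C / 4 ^ k"
    using s by (intro collision_error_le A C st mult_le_mono2) auto
  finally show ?thesis by simp
qed

lemma single_collision_less:
  fixes A B :: real and C k q s t :: nat
  assumes A: "1 \<le> A" "A \<le> B" and C: "1 \<le> C" "16 \<le> A ^ C" and q: "q \<ge> 1"
    and s: "1 \<le> s" "s < t" "t \<le> 2 * 2 ^ k"
  shows "measure lborel {a \<in> {A..B}. int q dvd \<lfloor>a ^ (gap C k * t)\<rfloor> - \<lfloor>a ^ (gap C k * s)\<rfloor>} \<le>
           (B - A) / real q + collision_const A B C / 4 ^ k"
proof (rule floor_power_collision_gap_le[OF A C q s, where G = "\<lambda>a. \<lfloor>a ^ (gap C k * s)\<rfloor>"])
  fix a assume a: "a \<in> {A..B}"
  hence "real_of_int \<lfloor>a ^ (gap C k * s)\<rfloor> \<le> a ^ (gap C k * s)" "0 \<le> a ^ (gap C k * s)"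
    using A by auto
  thus "real_of_int \<lfloor>a ^ (gap C k * s)\<rfloor> \<le> 3 * a ^ (gap C k * s)" by linarith
qed (use A in \<open>auto intro: floor_power_mono floor_power_ge_1\<close>)

lemma single_collision_le:
  fixes A B :: real and C k q :: nat
  assumes A: "1 \<le> A" "A \<le> B" and C: "1 \<le> C" "16 \<le> A ^ C" and q: "q \<ge> 1"
    and s: "1 \<le> s" "s \<le> 2 * 2 ^ k" and t: "1 \<le> t" "t \<le> 2 * 2 ^ k" and "s \<noteq> t"
  shows "measure lborel {a \<in> {A..B}. int q dvd \<lfloor>a ^ (gap C k * t)\<rfloor> - \<lfloor>a ^ (gap C k * s)\<rfloor>} \<le>
           (B - A) / real q + collision_const A B C / 4 ^ k"
proof (cases "s < t")
  case True
  thus ?thesis using single_collision_less[OF A C q s(1) True t(2)] by simp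
next
  case False
  hence "t < s" using \<open>s \<noteq> t\<close> by simp
  from single_collision_less[OF A C q t(1) this s(2)] show ?thesis
    by (subst dvd_diff_commute)
qed

text \<open>Here the larger exponent of \<open>p\<close> exceeds the three other exponents. The sum of the three lower
  integer parts is monotone in the base, and where it is constant so is each of its summands; hence it
  can serve as the function \<open>G\<close>.\<close>

lemma pair_collision_less:
  fixes A B :: real and C k q :: nat
  assumes A: "1 \<le> A" "A \<le> B" and C: "1 \<le> C" "16 \<le> A ^ C" and q: "q \<ge> 1"
    and p: "p \<in> pair_index k" "p' \<in> pair_index k" "snd p' < snd p"
  shows "measure lborel {a \<in> {A..B}. int q dvd pair_shift C k p a - pair_shift C k p' a} \<le>
           (B - A) / real q + collision_const A B C / 4 ^ k"
proof -
  define u where "u m a = \<lfloor>a ^ (gap C k * m)\<rfloor>" for m and a :: real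
  obtain s t s' t' where pq: "p = (s, t)" "p' = (s', t')" by (metis surj_pair)
  have r: "1 \<le> s" "s \<le> 2 ^ k" "1 \<le> s'" "s' \<le> 2 ^ k" "2 ^ k + 1 \<le> t'" "t' < t" "t \<le> 2 * 2 ^ k"
    using p by (auto simp: pair_index_def pq)
  have le: "real_of_int (u m a) \<le> a ^ (gap C k * t')" if "1 \<le> a" "m \<le> t'" for m a
    using that unfolding u_def by (intro floor_power_le_power) auto
  have mono: "u m a \<le> u m b" if "A \<le> a" "a \<le> b" for m a b
    unfolding u_def using that A by (intro floor_power_mono) auto
  have ge: "1 \<le> u m a" if "A \<le> a" for m a
    unfolding u_def using that A by (intro floor_power_ge_1) auto
  have "measure lborel {a \<in> {A..B}. int q dvd \<lfloor>a ^ (gap C k * t)\<rfloor> - (u t' a + u s' a - u s a)} \<le>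
           (B - A) / real q + collision_const A B C / 4 ^ k"
  proof (rule floor_power_collision_gap_le[OF A C q _ \<open>t' < t\<close> \<open>t \<le> 2 * 2 ^ k\<close>,
        where G = "\<lambda>a. u t' a + u s' a + u s a"])
    show "1 \<le> t'" using r by simp
  next
    fix a b assume "A \<le> a" "a \<le> b" "b \<le> B"
    thus "u t' a + u s' a + u s a \<le> u t' b + u s' b + u s b"
      by (intro add_mono mono)
  next
    fix a assume "a \<in> {A..B}"
    thus "1 \<le> u t' a + u s' a + u s a" using ge[of a t'] ge[of a s'] ge[of a s] by simp
  next
    fix a assume "a \<in> {A..B}"
    hence "1 \<le> a" using A by simp
    hence "real_of_int (u t' a) \<le> a ^ (gap C k * t')" "real_of_int (u s' a) \<le> a ^ (gap C k * t')"
      "real_of_int (u s a) \<le> a ^ (gap C k * t')" using r by (auto intro!: le)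
    thus "real_of_int (u t' a + u s' a + u s a) \<le> 3 * a ^ (gap C k * t')" by simp
  next
    have *: "u t' a = u t' b \<and> u s' a = u s' b \<and> u s a = u s b"
      if "A \<le> a" "a \<le> b" "u t' a + u s' a + u s a = u t' b + u s' b + u s b" for a b
      using mono[OF that(1,2), of t'] mono[OF that(1,2), of s'] mono[OF that(1,2), of s] that(3)
      by linarith
    fix a b assume ab: "a \<in> {A..B}" "b \<in> {A..B}"
      and eq: "u t' a + u s' a + u s a = u t' b + u s' b + u s b"
    show "u t' a + u s' a - u s a = u t' b + u s' b - u s b"
    proof (cases "a \<le> b")
      case True
      thus ?thesis using *[of a b] ab eq by simp
    next
      case False
      thus ?thesis using *[of b a] ab eq by simp
    qed
  qed
  also have "{a \<in> {A..B}. int q dvd \<lfloor>a ^ (gap C k * t)\<rfloor> - (u t' a + u s' a - u s a)} =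
             {a \<in> {A..B}. int q dvd pair_shift C k p a - pair_shift C k p' a}"
    by (simp add: pair_shift_def pq u_def algebra_simps)
  finally show ?thesis .
qed

text \<open>If the larger exponents of two distinct pairs agree, these terms cancel and a collision of two
  single powers remains.\<close>

lemma pair_collision_le:
  fixes A B :: real and C k q :: nat
  assumes A: "1 \<le> A" "A \<le> B" and C: "1 \<le> C" "16 \<le> A ^ C" and q: "q \<ge> 1"
    and p: "p \<in> pair_index k" "p' \<in> pair_index k" "p \<noteq> p'"
  shows "measure lborel {a \<in> {A..B}. int q dvd pair_shift C k p a - pair_shift C k p' a} \<le>
           (B - A) / real q + collision_const A B C / 4 ^ k"
proof -
  consider "snd p' < snd p" | "snd p < snd p'" | "snd p = snd p'" "fst p \<noteq> fst p'"
    using p(3) by (metis linorder_neqE_nat prod_eqI)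
  thus ?thesis
  proof cases
    case 1
    thus ?thesis using pair_collision_less[OF A C q p(1,2)] by simp
  next
    case 2
    from pair_collision_less[OF A C q p(2,1) this] show ?thesis by (subst dvd_diff_commute)
  next
    case 3
    have eq: "pair_shift C k p a - pair_shift C k p' a =
        \<lfloor>a ^ (gap C k * fst p)\<rfloor> - \<lfloor>a ^ (gap C k * fst p')\<rfloor>" for a
      using 3 by (simp add: pair_shift_def)
    show ?thesis unfolding eq
      using 3 p by (intro single_collision_le A C q) (auto simp: pair_index_def)
  qed
qed

lemma card_single_index: "card (single_index k) = 2 ^ k"
  by (simp add: single_index_def)

lemma card_pair_index: "card (pair_index k) = 4 ^ k"
proof -
  have "card (pair_index k) = 2 ^ k * 2 ^ k"
    by (simp add: pair_index_def card_cartesian_product)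
  thus ?thesis by (simp flip: power_mult_distrib)
qed

lemma AE_residue_variance_single:
  fixes A B :: real and C :: nat
  assumes A: "1 \<le> A" "A \<le> B" and C: "1 \<le> C" "16 \<le> A ^ C"
  shows "AE a in lborel. a \<in> {A..B} \<longrightarrow> (\<forall>\<^sub>F k in sequentially.
      (\<Sum>d\<in>{2..2 ^ k}. residue_variance (single_index k) (\<lambda>i. single_shift C k i a) (d\<^sup>2) / real d)
        < real (card (single_index k)) * (real k + 1) ^ 3)"
proof (rule AE_eventually_residue_variance_less[OF A(2), where D = "collision_const A B C"])
  fix k s t q
  assume st: "s \<in> single_index k" "t \<in> single_index k" "s \<noteq> t" and q: "(q::nat) \<ge> 1"
  have "measure lborel {a \<in> {A..B}. int q dvd single_shift C k s a - single_shift C k t a} \<le>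
      (B - A) / real q + collision_const A B C / 4 ^ k"
    unfolding single_shift_def
    using st by (intro single_collision_le A C q) (auto simp: single_index_def)
  also have "collision_const A B C / 4 ^ k \<le> collision_const A B C / 2 ^ k"
    using collision_const_nonneg[OF A] by (intro divide_left_mono power_mono) auto
  finally show "measure lborel {a \<in> {A..B}. int q dvd single_shift C k s a - single_shift C k t a} \<le>
      (B - A) / real q + collision_const A B C / real (card (single_index k))"
    by (simp add: card_single_index)
qed (use collision_const_nonneg[OF A] in \<open>auto simp: single_index_def single_shift_def\<close>)

lemma AE_residue_variance_pair:
  fixes A B :: real and C :: nat
  assumes A: "1 \<le> A" "A \<le> B" and C: "1 \<le> C" "16 \<le> A ^ C"
  shows "AE a in lborel. a \<in> {A..B} \<longrightarrow> (\<forall>\<^sub>F k in sequentially.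
      (\<Sum>d\<in>{2..2 ^ k}. residue_variance (pair_index k) (\<lambda>i. pair_shift C k i a) (d\<^sup>2) / real d)
        < real (card (pair_index k)) * (real k + 1) ^ 3)"
proof (rule AE_eventually_residue_variance_less[OF A(2), where D = "collision_const A B C"])
  fix k p p' q
  assume "p \<in> pair_index k" "p' \<in> pair_index k" "p \<noteq> p'" "(q::nat) \<ge> 1"
  thus "measure lborel {a \<in> {A..B}. int q dvd pair_shift C k p a - pair_shift C k p' a} \<le>
      (B - A) / real q + collision_const A B C / real (card (pair_index k))"
    using pair_collision_le[OF A C] by (simp add: card_pair_index)
qed (use collision_const_nonneg[OF A] in \<open>auto simp: pair_index_def pair_shift_def\<close>)

section \<open>From dyadic scales to asymptotic bounds\<close>

text \<open>The second moment bound with \<open>P = 2 ^ k\<close>, for shifts of variance as small as holds almost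
  surely.\<close>

lemma counting_exceptional_set_le:
  fixes I :: "'i set" and v :: "'i \<Rightarrow> int" and S :: "int set" and k V :: nat and x \<kappa> \<rho> :: real
  assumes I: "finite I" "I \<noteq> {}" and S: "\<And>i. i \<in> I \<Longrightarrow> v i \<in> S"
    and v: "\<And>i. i \<in> I \<Longrightarrow> 0 \<le> v i \<and> v i \<le> int V"
    and k: "k \<ge> 1" and x: "4 ^ k \<le> x" "real V * 2 ^ k \<le> x"
    and var: "(\<Sum>d\<in>{2..2 ^ k}. residue_variance I v (d\<^sup>2) / real d) \<le> real (card I) * (real k + 1) ^ 3"
    and \<rho>: "(real k + 1) ^ 4 / real (card I) \<le> \<kappa> * \<rho> / 2 ^ k" "1 \<le> \<rho>"
  shows "real (counting_function (exceptional_set S) x) \<le> (17 + 128 * \<kappa>) * x * \<rho> / 2 ^ k"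
proof -
  define X where "X = nat \<lfloor>x\<rfloor>"
  define T where "T = real (card I)"
  define E where "E = {n \<in> {1..int X}. \<forall>i\<in>I. n - v i \<notin> squarefree_set}"
  have T: "T > 0" using I by (simp add: T_def card_gt_0_iff)
  have x0: "0 < x" using x(1) by (smt (verit) zero_less_power)
  have Xx: "real X \<le> x" using x0 by (simp add: X_def)
  have "int (4 ^ k) \<le> \<lfloor>x\<rfloor>" using x(1) by (simp add: le_floor_iff)
  hence "4 ^ k \<le> X" by (simp add: X_def nat_le_iff le_nat_iff)
  hence PX: "(2 ^ k)\<^sup>2 \<le> X" by (simp add: power2_eq_square flip: power_mult_distrib)
  have P2: "2 \<le> (2::nat) ^ k" using k by (cases k) auto
  have sub: "{n \<in> exceptional_set S. 0 < n \<and> real_of_int n \<le> x} \<subseteq> E"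
  proof
    fix n assume n: "n \<in> {n \<in> exceptional_set S. 0 < n \<and> real_of_int n \<le> x}"
    hence "n \<le> \<lfloor>x\<rfloor>" "0 < n" by (auto simp: le_floor_iff)
    hence "n \<in> {1..int X}" using x0 by (simp add: X_def)
    moreover have "n - v i \<notin> squarefree_set" if "i \<in> I" for i
    proof
      assume "n - v i \<in> squarefree_set"
      from set_plus_intro[OF this S[OF that]] have "n \<in> squarefree_set + S" by simp
      thus False using n by (simp add: exceptional_set_def)
    qed
    ultimately show "n \<in> E" by (simp add: E_def)
  qed
  have "finite E" by (rule finite_subset[of _ "{1..int X}"]) (auto simp: E_def)
  hence "real (counting_function (exceptional_set S) x) \<le> real (card E)"
    unfolding counting_function_def using sub by (simp add: card_mono)
  also have "\<dots> \<le> real V + 16 * real X / real (2 ^ k) + 128 * real X / T\<^sup>2 *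
            (\<Sum>d\<in>{2..2 ^ k}. 1 / real d) * (\<Sum>d\<in>{2..2 ^ k}. residue_variance I v (d\<^sup>2) / real d)"
    unfolding E_def T_def by (rule card_not_squarefree_plus_shifts_le[OF I v P2 PX])
  also have "\<dots> \<le> x / 2 ^ k + 16 * x / 2 ^ k + 128 * x / T\<^sup>2 * (real k + 1) * (T * (real k + 1) ^ 3)"
  proof (intro add_mono mult_mono divide_right_mono sum_inverse_dyadic_le)
    show "real V \<le> x / 2 ^ k" using x(2) by (simp add: field_simps)
    show "0 \<le> (\<Sum>d\<in>{2..2 ^ k}. residue_variance I v (d\<^sup>2) / real d)"
      by (intro sum_nonneg divide_nonneg_nonneg residue_variance_nonneg) auto
  qed (use Xx x0 T var in \<open>auto simp: T_def intro!: divide_right_mono sum_nonneg\<close>)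
  also have "128 * x / T\<^sup>2 * (real k + 1) * (T * (real k + 1) ^ 3) = 128 * x * ((real k + 1) ^ 4 / T)"
    using T by (simp add: power2_eq_square power4_eq_xxxx power3_eq_cube)
  also have "\<dots> \<le> 128 * x * (\<kappa> * \<rho> / 2 ^ k)"
    using \<rho>(1) x0 by (intro mult_left_mono) (auto simp: T_def)
  also have "x / 2 ^ k + 16 * x / 2 ^ k \<le> 17 * x * \<rho> / 2 ^ k"
  proof -
    have "17 * x * 1 \<le> 17 * x * \<rho>" using \<rho>(2) x0 by (intro mult_left_mono) auto
    thus ?thesis by (simp add: divide_right_mono flip: add_divide_distrib)
  qed
  finally show ?thesis by (simp add: algebra_simps add_divide_distrib)
qed

text \<open>For \<open>y = ln x\<close>, the largest scale \<open>k\<close> for which all shifts are small compared with \<open>x\<close> satisfies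
  \<open>2 ^ k \<ge> c * ln x / ln (ln x)\<close> with a constant \<open>c > 0\<close>.\<close>

lemma dyadic_scale_obtains:
  fixes E y :: real and k0 :: nat
  assumes E: "E \<ge> 1" and y: "E * real (Suc k0) * 2 ^ k0 \<le> y" and k0: "k0 \<ge> 1"
  obtains k where "k0 \<le> k" "E * real (Suc k) * 2 ^ k \<le> y"
    "1 / 2 ^ k \<le> 4 * E * real (Suc k) / y" "real (Suc k) \<le> 4 * ln y" "0 < y" "0 < ln y"
proof -
  define M where "M = {k. E * real (Suc k) * 2 ^ k \<le> y}"
  have le: "real k \<le> E * real (Suc k) * 2 ^ k" "2 ^ k \<le> E * real (Suc k) * 2 ^ k" for k
  proof -
    have "1 * real (Suc k) \<le> E * real (Suc k)" using E by (intro mult_right_mono) auto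
    hence 1: "real (Suc k) \<le> E * real (Suc k)" by simp
    have "E * real (Suc k) * 1 \<le> E * real (Suc k) * 2 ^ k"
      using E by (intro mult_left_mono) auto
    with 1 show "real k \<le> E * real (Suc k) * 2 ^ k" by linarith
    have "1 \<le> E * real (Suc k)" by (rule order_trans[OF _ 1]) simp
    hence "1 * 2 ^ k \<le> E * real (Suc k) * 2 ^ k"
      by (intro mult_right_mono) auto
    thus "2 ^ k \<le> E * real (Suc k) * 2 ^ k" by simp
  qed
  have "M \<subseteq> {..nat \<lfloor>y\<rfloor>}"
  proof
    fix k assume "k \<in> M"
    hence "real k \<le> y" using le(1)[of k] by (simp add: M_def)
    thus "k \<in> {..nat \<lfloor>y\<rfloor>}" by (simp add: le_nat_floor)
  qed
  hence fin: "finite M" by (rule finite_subset) simp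
  have k0M: "k0 \<in> M" using y by (simp add: M_def)
  define k where "k = Max M"
  have kM: "k \<in> M" unfolding k_def using fin k0M by (intro Max_in) auto
  have kk0: "k0 \<le> k" unfolding k_def using fin k0M by simp
  have "Suc k \<notin> M" using Max_ge[OF fin, of "Suc k"] unfolding k_def[symmetric] by auto
  hence less: "y < E * real (Suc (Suc k)) * 2 ^ Suc k" by (simp add: M_def)
  have "(2::real) ^ 1 \<le> 2 ^ k" using kk0 k0 by (intro power_increasing) auto
  moreover have "2 ^ k \<le> y" by (rule order_trans[OF le(2)]) (use kM in \<open>simp only: M_def mem_Collect_eq\<close>)
  ultimately have two: "2 ^ k \<le> y" "2 \<le> y" by auto
  note less
  also have "E * real (Suc (Suc k)) * 2 ^ Suc k \<le> E * (2 * real (Suc k)) * 2 ^ Suc k"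
    using E by (intro mult_right_mono mult_left_mono) auto
  also have "\<dots> = (4 * E * real (Suc k)) * 2 ^ k" by simp
  finally have y_less: "y < (4 * E * real (Suc k)) * 2 ^ k" .
  hence 1: "1 / 2 ^ k \<le> 4 * E * real (Suc k) / y"
  proof -
    have "1 / 2 ^ k \<le> c / y" if "y < c * 2 ^ k" for c
      using that two by (simp add: field_simps)
    from this[OF y_less] show ?thesis .
  qed
  have "ln (2 ^ k) \<le> ln y" using two by (intro ln_mono) auto
  hence "real k * ln 2 \<le> ln y" by (simp add: ln_realpow)
  moreover have "1 / 2 \<le> ln (2 :: real)"
    using ln_le_minus_one[of "1 / 2 :: real"] by (simp add: ln_div)
  hence "real k * (1 / 2) \<le> real k * ln 2"
    by (intro mult_left_mono) auto
  ultimately have half: "real k * (1 / 2) \<le> ln y" by linarith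
  have "1 \<le> real k" using kk0 k0 by simp
  hence "real (Suc k) \<le> 4 * ln y" using half by simp
  moreover have "0 < ln y" using two by simp
  moreover have "E * real (Suc k) * 2 ^ k \<le> y" using kM by (simp only: M_def mem_Collect_eq)
  moreover have "0 < y" using two by simp
  ultimately show ?thesis using that[of k] kk0 1 by blast
qed

text \<open>The exponent \<open>r\<close> measures how far \<open>(k + 1) ^ 4 / card (I k)\<close> exceeds \<open>1 / 2 ^ k\<close>: for single powers, where
  \<open>card (I k) = 2 ^ k\<close>, it is 4, and for pairs, where \<open>card (I k) = 4 ^ k\<close>, it is 0.\<close>

lemma counting_exceptional_set_bigo:
  fixes I :: "nat \<Rightarrow> 'i set" and v :: "nat \<Rightarrow> 'i \<Rightarrow> int" and S :: "int set"
    and B \<kappa> :: real and C r :: nat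
  assumes I: "\<And>k. finite (I k)" "\<And>k. I k \<noteq> {}" and S: "\<And>k i. i \<in> I k \<Longrightarrow> v k i \<in> S"
    and B: "B \<ge> 1"
    and v0: "\<And>k i. i \<in> I k \<Longrightarrow> 0 \<le> v k i"
    and v: "\<And>k i. i \<in> I k \<Longrightarrow> real_of_int (v k i) \<le> 2 * B ^ (gap C k * (2 * 2 ^ k))"
    and var: "\<forall>\<^sub>F k in sequentially.
      (\<Sum>d\<in>{2..2 ^ k}. residue_variance (I k) (v k) (d\<^sup>2) / real d) < real (card (I k)) * (real k + 1) ^ 3"
    and \<kappa>: "\<And>k. (real k + 1) ^ 4 / real (card (I k)) \<le> \<kappa> * (real k + 1) ^ r / 2 ^ k"
  shows "(\<lambda>x. real (counting_function (exceptional_set S) x)) \<in>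
           O[at_top](\<lambda>x. x * ln (ln x) ^ Suc r / ln x)"
proof -
  obtain k1 where k1: "\<And>k. k \<ge> k1 \<Longrightarrow>
      (\<Sum>d\<in>{2..2 ^ k}. residue_variance (I k) (v k) (d\<^sup>2) / real d) < real (card (I k)) * (real k + 1) ^ 3"
    using var by (auto simp: eventually_sequentially)
  define k0 where "k0 = max 1 k1"
  \<comment> \<open>The summand 3 makes room for the factor \<open>8 ^ (k + 1)\<close>, as \<open>8 \<le> exp 3\<close>.\<close>
  define E where "E = 2 * real C * ln B + 3"
  define K where "K = (17 + 128 * \<kappa>) * (4 ^ r * (16 * E))"
  have \<kappa>_nn: "0 \<le> \<kappa>"
  proof -
    have "0 \<le> (real 0 + 1) ^ 4 / real (card (I 0))" by simp
    also have "\<dots> \<le> \<kappa>" using \<kappa>[of 0] by simp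
    finally show ?thesis .
  qed
  have E: "E \<ge> 3" using B by (simp add: E_def)
  have "\<forall>\<^sub>F x in at_top. exp (E * real (Suc k0) * 2 ^ k0) \<le> x" by (rule eventually_ge_at_top)
  hence "\<forall>\<^sub>F x in at_top. norm (real (counting_function (exceptional_set S) x)) \<le>
           K * norm (x * ln (ln x) ^ Suc r / ln x)"
  proof eventually_elim
    case (elim x)
    have x0: "0 < x" using elim by (rule less_le_trans[OF exp_gt_zero])
    hence "E * real (Suc k0) * 2 ^ k0 \<le> ln x" using elim by (simp add: ln_ge_iff)
    then obtain k where k: "k0 \<le> k" "E * real (Suc k) * 2 ^ k \<le> ln x"
      "1 / 2 ^ k \<le> 4 * E * real (Suc k) / ln x" "real (Suc k) \<le> 4 * ln (ln x)" "0 < ln x" "0 < ln (ln x)"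
      using dyadic_scale_obtains[of E k0 "ln x"] E by (auto simp: k0_def)
    define W where "W = B ^ (gap C k * (2 * 2 ^ k))"
    have W: "W * 8 ^ Suc k \<le> x"
    proof -
      have "W = exp (real (gap C k * (2 * 2 ^ k)) * ln B)"
        using B by (simp only: W_def exp_of_nat_mult) simp
      also have "real (gap C k * (2 * 2 ^ k)) * ln B = 2 * real C * ln B * (real (Suc k) * 2 ^ k)"
        by (simp add: gap_def algebra_simps)
      finally have W_eq: "W = exp (2 * real C * ln B * (real (Suc k) * 2 ^ k))" .
      have "(8::real) = 2 ^ 3" by simp
      also have "\<dots> \<le> exp 1 ^ 3" using exp_ge_add_one_self[of 1] by (intro power_mono) auto
      also have "\<dots> = exp 3" by (simp flip: exp_of_nat_mult)
      finally have "(8::real) ^ Suc k \<le> exp 3 ^ Suc k" by (intro power_mono) auto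
      also have "\<dots> = exp (3 * (real (Suc k) * 1))" by (simp only: exp_of_nat_mult[symmetric] mult_ac mult_1)
      also have "\<dots> \<le> exp (3 * (real (Suc k) * 2 ^ k))"
        by (simp only: exp_le_cancel_iff) (intro mult_left_mono, auto)
      finally have "W * 8 ^ Suc k \<le> W * exp (3 * (real (Suc k) * 2 ^ k))"
        unfolding W_eq by (intro mult_left_mono) auto
      also have "\<dots> = exp (E * real (Suc k) * 2 ^ k)"
        unfolding W_eq exp_add[symmetric] by (simp add: E_def algebra_simps)
      also have "\<dots> \<le> exp (ln x)" using k(2) by simp
      finally show ?thesis using x0 by simp
    qed
    have W1: "1 \<le> W" unfolding W_def using B by (rule one_le_power)
    define V where "V = nat \<lfloor>2 * W\<rfloor>"
    have V: "real V \<le> 2 * W" using W1 by (simp add: V_def)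
    have pow: "(2::real) ^ k \<le> 4 ^ k" "(4::real) ^ k \<le> 8 ^ k" by (intro power_mono; simp)+
    have x1: "4 ^ k \<le> x"
    proof -
      have "(4::real) ^ k \<le> 1 * 8 ^ Suc k"
        unfolding power_Suc mult_1 using pow(2) zero_le_power[of "8::real" k] by linarith
      also have "\<dots> \<le> W * 8 ^ Suc k" using W1 by (intro mult_right_mono) auto
      finally show ?thesis using W by linarith
    qed
    have x2: "real V * 2 ^ k \<le> x"
    proof -
      have "real V * 2 ^ k \<le> (2 * W) * 8 ^ k" using V W1 pow by (intro mult_mono) auto
      also have "\<dots> \<le> W * 8 ^ Suc k" using W1 by simp
      finally show ?thesis using W by linarith
    qed
    have "real (counting_function (exceptional_set S) x) \<le> (17 + 128 * \<kappa>) * x * (real k + 1) ^ r / 2 ^ k"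
    proof (rule counting_exceptional_set_le[OF I S _ _ x1 x2 _ \<kappa>])
      fix i assume i: "i \<in> I k"
      have "v k i \<le> \<lfloor>2 * W\<rfloor>" using v[OF i] by (simp add: W_def le_floor_iff)
      thus "0 \<le> v k i \<and> v k i \<le> int V" using v0[OF i] W1 by (simp add: V_def)
    next
      show "1 \<le> k" using k(1) by (simp add: k0_def)
    next
      show "(\<Sum>d = 2..2 ^ k. residue_variance (I k) (v k) (d\<^sup>2) / real d) \<le> real (card (I k)) * (real k + 1) ^ 3"
        using k1[of k] k(1) by (simp add: k0_def)
    qed auto
    also have "\<dots> = (17 + 128 * \<kappa>) * x * (real (Suc k) ^ r * (1 / 2 ^ k))" by (simp add: add.commute)
    also have "\<dots> \<le> (17 + 128 * \<kappa>) * x * ((4 * ln (ln x)) ^ r * (4 * E * (4 * ln (ln x)) / ln x))"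
    proof (intro mult_left_mono mult_mono power_mono k(4))
      have "1 / 2 ^ k \<le> 4 * E * real (Suc k) / ln x" by (rule k(3))
      also have "\<dots> \<le> 4 * E * (4 * ln (ln x)) / ln x"
        using k E by (intro divide_right_mono mult_left_mono) auto
      finally show "1 / 2 ^ k \<le> 4 * E * (4 * ln (ln x)) / ln x" .
    qed (use \<kappa>_nn x0 k in auto)
    also have "\<dots> = K * (x * ln (ln x) ^ Suc r / ln x)"
      by (simp add: K_def power_mult_distrib)
    also have "x * ln (ln x) ^ Suc r / ln x = norm (x * ln (ln x) ^ Suc r / ln x)"
      using x0 k by simp
    finally show ?case by simp
  qed
  thus ?thesis by (rule bigoI)
qed

lemma bounded_fourth_power_over_exponential:
  "\<exists>c::real. \<forall>k::nat. (real k + 1) ^ 4 / 4 ^ k \<le> c / 2 ^ k"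
proof -
  have "(\<lambda>k::nat. (real k + 1) ^ 4 / 2 ^ k) \<longlonglongrightarrow> 0" by real_asymp
  hence "Bseq (\<lambda>k::nat. (real k + 1) ^ 4 / 2 ^ k)" by (intro convergent_imp_Bseq) (auto simp: convergent_def)
  then obtain c where c: "\<And>k::nat. norm ((real k + 1) ^ 4 / 2 ^ k) \<le> c" by (auto simp: Bseq_def)
  have "(real k + 1) ^ 4 / 4 ^ k \<le> c / 2 ^ k" for k :: nat
  proof -
    have "(real k + 1) ^ 4 / 4 ^ k = (real k + 1) ^ 4 / 2 ^ k / 2 ^ k"
      by (simp flip: power_mult_distrib)
    also have "\<dots> \<le> c / 2 ^ k" using c[of k] by (intro divide_right_mono) auto
    finally show ?thesis .
  qed
  thus ?thesis by blast
qed

text \<open>On a compact interval of bases the number \<open>C\<close> can be chosen uniformly.\<close>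

lemma AE_exceptional_set_bigo_interval:
  fixes A B :: real
  assumes A: "1 < A" "A \<le> B"
  shows "AE a in lborel. a \<in> {A..B} \<longrightarrow>
    (\<lambda>x. real (counting_function (exceptional_set (floor_powers a)) x)) \<in>
      O[at_top](\<lambda>x. x * ln (ln x) ^ 5 / ln x) \<and>
    (\<lambda>x. real (counting_function (exceptional_set (floor_power_sums a)) x)) \<in>
      O[at_top](\<lambda>x. x * ln (ln x) ^ 1 / ln x)"
proof -
  obtain C0 where "16 < A ^ C0" using real_arch_pow[OF A(1)] by blast
  moreover define C where "C = Suc C0"
  moreover have "A ^ C0 \<le> A ^ C" unfolding C_def using A by (intro power_increasing) auto
  ultimately have C: "1 \<le> C" "16 \<le> A ^ C" by (simp add: C_def, linarith)
  have A': "1 \<le> A" using A by simp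
  obtain c :: real where c: "\<And>k::nat. (real k + 1) ^ 4 / 4 ^ k \<le> c / 2 ^ k"
    using bounded_fourth_power_over_exponential by blast
  show ?thesis
    using AE_residue_variance_single[OF A' A(2) C] AE_residue_variance_pair[OF A' A(2) C]
  proof eventually_elim
    case (elim a)
    show ?case
    proof
      assume a: "a \<in> {A..B}"
      hence a1: "1 \<le> a" using A by simp
      have gap: "gap C k \<ge> 1" for k using C by (simp add: gap_def)
      have le: "real_of_int \<lfloor>a ^ (gap C k * t)\<rfloor> \<le> a ^ (gap C k * (2 * 2 ^ k))"
        and ge: "0 \<le> \<lfloor>a ^ (gap C k * t)\<rfloor>" if "t \<le> 2 * 2 ^ k" for k t
        using that a1 floor_power_ge_1[OF a1, of "gap C k * t"]
        by (auto intro!: floor_power_le_power mult_le_mono2)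
      have "(\<lambda>x. real (counting_function (exceptional_set (floor_powers a)) x)) \<in>
          O[at_top](\<lambda>x. x * ln (ln x) ^ Suc 4 / ln x)"
      proof (rule counting_exceptional_set_bigo[where I = single_index and B = a and C = C and \<kappa> = 1
            and v = "\<lambda>k t. single_shift C k t a"])
        fix k t assume t: "t \<in> single_index k"
        hence "1 \<le> gap C k * t" using gap[of k] by (simp add: single_index_def)
        thus "single_shift C k t a \<in> floor_powers a"
          by (auto simp: single_shift_def floor_powers_def)
        have "t \<le> 2 * 2 ^ k" using t by (simp add: single_index_def)
        moreover have "0 \<le> a ^ (gap C k * (2 * 2 ^ k))" using a1 by simp
        ultimately show "real_of_int (single_shift C k t a) \<le> 2 * a ^ (gap C k * (2 * 2 ^ k))"
          "0 \<le> single_shift C k t a"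
          using le[of t k] ge[of t k] by (simp_all add: single_shift_def)
      qed (use elim(1) a a1 in \<open>auto simp: single_index_def\<close>)
      moreover have "(\<lambda>x. real (counting_function (exceptional_set (floor_power_sums a)) x)) \<in>
          O[at_top](\<lambda>x. x * ln (ln x) ^ Suc 0 / ln x)"
      proof (rule counting_exceptional_set_bigo[where I = pair_index and B = a and C = C and \<kappa> = c
            and v = "\<lambda>k p. pair_shift C k p a"])
        fix k p assume p: "p \<in> pair_index k"
        hence st: "1 \<le> fst p" "fst p < snd p" "snd p \<le> 2 * 2 ^ k" by (auto simp: pair_index_def)
        hence "1 \<le> gap C k * fst p" "gap C k * fst p < gap C k * snd p" using gap[of k] by auto
        thus "pair_shift C k p a \<in> floor_power_sums a"
          unfolding pair_shift_def floor_power_sums_def by blast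
        show "real_of_int (pair_shift C k p a) \<le> 2 * a ^ (gap C k * (2 * 2 ^ k))"
          "0 \<le> pair_shift C k p a"
          using le[of "fst p" k] ge[of "fst p" k] le[of "snd p" k] ge[of "snd p" k] st
          by (simp_all add: pair_shift_def)
      next
        show "(real k + 1) ^ 4 / real (card (pair_index k)) \<le> c * (real k + 1) ^ 0 / 2 ^ k" for k
          using c[of k] by (simp add: card_pair_index)
      qed (use elim(2) a a1 in \<open>auto simp: pair_index_def\<close>)
      ultimately show "(\<lambda>x. real (counting_function (exceptional_set (floor_powers a)) x)) \<in>
            O[at_top](\<lambda>x. x * ln (ln x) ^ 5 / ln x) \<and>
          (\<lambda>x. real (counting_function (exceptional_set (floor_power_sums a)) x)) \<in>
            O[at_top](\<lambda>x. x * ln (ln x) ^ 1 / ln x)"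
        by simp
    qed
  qed
qed

lemma AE_exceptional_set_bigo:
  "AE a :: real in lborel. a > 1 \<longrightarrow>
    (\<lambda>x. real (counting_function (exceptional_set (floor_powers a)) x)) \<in>
      O[at_top](\<lambda>x. x * ln (ln x) ^ 5 / ln x) \<and>
    (\<lambda>x. real (counting_function (exceptional_set (floor_power_sums a)) x)) \<in>
      O[at_top](\<lambda>x. x * ln (ln x) ^ 1 / ln x)"
proof -
  define P where "P a \<longleftrightarrow>
    (\<lambda>x. real (counting_function (exceptional_set (floor_powers a)) x)) \<in>
      O[at_top](\<lambda>x. x * ln (ln x) ^ 5 / ln x) \<and>
    (\<lambda>x. real (counting_function (exceptional_set (floor_power_sums a)) x)) \<in>
      O[at_top](\<lambda>x. x * ln (ln x) ^ 1 / ln x)" for a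
  have "AE a in lborel. \<forall>j. a \<in> {1 + 1 / real (Suc j)..real j + 2} \<longrightarrow> P a"
    unfolding AE_all_countable P_def
    by (intro allI AE_exceptional_set_bigo_interval) (auto simp: field_simps)
  hence "AE a in lborel. a > 1 \<longrightarrow> P a"
  proof eventually_elim
    case (elim a)
    show ?case
    proof
      assume a: "a > 1"
      obtain j :: nat where j: "max (1 / (a - 1)) a < real j" using reals_Archimedean2 by blast
      hence "1 / (a - 1) < real (Suc j)" by simp
      hence "1 / real (Suc j) < a - 1" using a by (simp add: field_simps)
      hence "a \<in> {1 + 1 / real (Suc j)..real j + 2}" using j by simp
      thus "P a" using elim by blast
    qed
  qed
  thus ?thesis by (simp add: P_def)
qed

lemma has_asymptotic_density_0I:
  assumes O: "(\<lambda>x. real (counting_function S x)) \<in> O[at_top](f)"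
    and f: "((\<lambda>x. f x / x) \<longlongrightarrow> 0) at_top"
  shows "has_asymptotic_density S 0"
proof -
  obtain c where c: "\<forall>\<^sub>F x in at_top. norm (real (counting_function S x)) \<le> c * norm (f x)"
    using landau_o.bigE[OF O] by blast
  have "\<forall>\<^sub>F x in at_top. norm (real (counting_function S x) / x) \<le> norm (f x / x) * c"
    using c eventually_gt_at_top[of 0]
    by eventually_elim (simp add: divide_right_mono mult.commute)
  hence "((\<lambda>x. real (counting_function S x) / x) \<longlongrightarrow> 0) at_top"
    by (rule tendsto_0_le[OF f])
  hence "(\<lambda>N. real (counting_function S (real N)) / real N) \<longlonglongrightarrow> 0"
    by (rule filterlim_compose) (rule filterlim_real_sequentially)
  moreover have "counting_function S (real N) = card (S \<inter> {1..int N})" for N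
  proof -
    have iff: "real_of_int n \<le> real N \<longleftrightarrow> n \<le> int N" for n by linarith
    have "{n \<in> S. 0 < n \<and> real_of_int n \<le> real N} = S \<inter> {1..int N}"
      unfolding iff by auto
    thus ?thesis by (simp add: counting_function_def)
  qed
  ultimately show ?thesis by (simp add: has_asymptotic_density_def)
qed

theorem theorem1p5:
  shows "AE a :: real in lebesgue. a > 1 \<longrightarrow>
    (\<forall>\<epsilon> :: real. \<epsilon> > 0 \<longrightarrow>
       (\<lambda>x :: real. real (counting_function (exceptional_set (floor_powers a)) x))
         \<in> O[at_top](\<lambda>x. x * ln (ln x) powr (1 + \<epsilon>) / sqrt (ln x)) \<and>
       (\<lambda>x :: real. real (counting_function (exceptional_set (floor_power_sums a)) x))
         \<in> O[at_top](\<lambda>x. x * ln (ln x) powr (1 + \<epsilon>) / ln x)) \<and>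
    has_asymptotic_density (exceptional_set (floor_powers a)) 0 \<and>
    has_asymptotic_density (exceptional_set (floor_power_sums a)) 0"
  using AE_completion[OF AE_exceptional_set_bigo]
proof (rule AE_mp, intro AE_I2 impI)
  fix a :: real
  let ?f = "\<lambda>x. real (counting_function (exceptional_set (floor_powers a)) x)"
  let ?g = "\<lambda>x. real (counting_function (exceptional_set (floor_power_sums a)) x)"
  assume "a > 1 \<longrightarrow> ?f \<in> O[at_top](\<lambda>x. x * ln (ln x) ^ 5 / ln x) \<and>
                    ?g \<in> O[at_top](\<lambda>x. x * ln (ln x) ^ 1 / ln x)" and "a > 1"
  hence f: "?f \<in> O[at_top](\<lambda>x. x * ln (ln x) ^ 5 / ln x)"
    and g: "?g \<in> O[at_top](\<lambda>x. x * ln (ln x) ^ 1 / ln x)" by auto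
  have "?f \<in> O[at_top](\<lambda>x. x * ln (ln x) powr (1 + \<epsilon>) / sqrt (ln x)) \<and>
        ?g \<in> O[at_top](\<lambda>x. x * ln (ln x) powr (1 + \<epsilon>) / ln x)" if \<epsilon>: "\<epsilon> > 0" for \<epsilon>
  proof
    have "(\<lambda>x::real. x * ln (ln x) ^ 5 / ln x) \<in> O[at_top](\<lambda>x. x * ln (ln x) powr (1 + \<epsilon>) / sqrt (ln x))"
      using \<epsilon> by real_asymp
    with f show "?f \<in> O[at_top](\<lambda>x. x * ln (ln x) powr (1 + \<epsilon>) / sqrt (ln x))"
      by (rule landau_o.big_trans)
    have "(\<lambda>x::real. x * ln (ln x) ^ 1 / ln x) \<in> O[at_top](\<lambda>x. x * ln (ln x) powr (1 + \<epsilon>) / ln x)"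
      using \<epsilon> by real_asymp
    with g show "?g \<in> O[at_top](\<lambda>x. x * ln (ln x) powr (1 + \<epsilon>) / ln x)"
      by (rule landau_o.big_trans)
  qed
  moreover have "has_asymptotic_density (exceptional_set (floor_powers a)) 0"
    by (rule has_asymptotic_density_0I[OF f]) real_asymp
  moreover have "has_asymptotic_density (exceptional_set (floor_power_sums a)) 0"
    by (rule has_asymptotic_density_0I[OF g]) real_asymp
  ultimately show "(\<forall>\<epsilon> :: real. \<epsilon> > 0 \<longrightarrow>
       ?f \<in> O[at_top](\<lambda>x. x * ln (ln x) powr (1 + \<epsilon>) / sqrt (ln x)) \<and>
       ?g \<in> O[at_top](\<lambda>x. x * ln (ln x) powr (1 + \<epsilon>) / ln x)) \<and>
    has_asymptotic_density (exceptional_set (floor_powers a)) 0 \<and>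
    has_asymptotic_density (exceptional_set (floor_power_sums a)) 0"
    by blast
qed

end
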